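(* Let $k$ be a field of odd characteristic, let $G$ be either the split orthogonal group $O(d,k)$ with $d=2l$ or $d=2l+1$, or the symplectic group $\mathrm{Sp}(d,k)$ with $d=2l$, and let $P$ be the Siegel maximal parabolic subgroup of $G$. Let $$\widehat W=\{\omega_0=I,\ \omega_i=w_1w_2\cdots w_i\mid 1\le i\le l\}.$$ Then there is an efficient algorithm (one using a number of operations in $k$ polynomial in $l$) which, given $g\in G$, determines $\omega\in\widehat W$ such that $g\in P\omega P$. Furthermore, $\widehat W$, the set of all such $\omega$, is a finite set of $l+1$ elements.
   Context: Rows and columns are indexed in the order $1,\ldots,l,-1,\ldots,-l$ if $d=2l$ and $0,1,\ldots,l,-1,\ldots,-l$ if $d=2l+1$; $\{e_a\}$ is the standard basis of $V=k^d$, $I$ the identity matrix, $e_{a,b}$ the matrix unit with $1$ in place $(a,b)$. $G=\{g\in GL(d,k):{}^Tg\beta g=\beta\}$, where $\beta=\begin{pmatrix}0 & I_l \\ -I_l & 0\end{pmatrix}$ for $\mathrm{Sp}(2l,k)$, $\beta=\begin{pmatrix}0 & I_l \\ I_l & 0\end{pmatrix}$ for $O(2l,k)$, and $\beta=\begin{pmatrix}2 & 0 & 0 \\ 0 & 0 & I_l \\ 0 & I_l & 0\end{pmatrix}$ for $O(2l+1,k)$. The Siegel maximal parabolic $P$ is the stabilizer in $G$ of the flag $\{0\}\subset\langle e_1,\ldots,e_l\rangle\subset V$. It consists of the elements of $G$ of the form $\begin{pmatrix}A & B \\ 0 & D\end{pmatrix}$ when $d=2l$, and $\begin{pmatrix}\alpha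 & 0 & Y \\ E & A & B \\ F & 0 & D\end{pmatrix}$ when $d=2l+1$ (with $A,B,D$ of size $l\times l$, $\alpha\in k$). The elements $w_i$ ($1\le i\le l$) are: for $O(2l,k)$, $w_i=I-e_{i,i}-e_{-i,-i}+e_{i,-i}+e_{-i,i}$; for $\mathrm{Sp}(2l,k)$, $w_i=(I+e_{i,-i})(I-e_{-i,i})(I+e_{i,-i})=I-e_{i,i}-e_{-i,-i}+e_{i,-i}-e_{-i,i}$; for $O(2l+1,k)$, $w_i=I-2e_{0,0}-e_{i,i}-e_{-i,-i}-e_{i,-i}-e_{-i,i}$. *)

theory Defs
  imports
    Jordan_Normal_Form.VS_Connect
    "HOL-Computational_Algebra.Polynomial"
begin

section \<open>The groups and the Siegel parabolic\<close>

datatype family = Symplectic | Even_Orthogonal | Odd_Orthogonal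

fun dimn :: "family \<Rightarrow> nat \<Rightarrow> nat" where
  "dimn Symplectic l = 2 * l"
| "dimn Even_Orthogonal l = 2 * l"
| "dimn Odd_Orthogonal l = 2 * l + 1"

text \<open>Rows and columns carry the labels \<open>1, \<dots>, l, -1, \<dots>, -l\<close>, preceded by \<open>0\<close> in the odd
  orthogonal case; \<open>pos F l a\<close> is the (0-based) matrix position of the label \<open>a\<close>.\<close>

definition pos :: "family \<Rightarrow> nat \<Rightarrow> int \<Rightarrow> nat" where
  "pos F l a =
    (let s = (if F = Odd_Orthogonal then 1 else 0) in
     if a > 0 then s + nat a - 1
     else if a < 0 then s + l + nat (- a) - 1
     else 0)"

definition basis_vec :: "family \<Rightarrow> nat \<Rightarrow> int \<Rightarrow> 'k::field vec" where
  "basis_vec F l a = unit_vec (dimn F l) (pos F l a)"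

definition matrix_unit :: "family \<Rightarrow> nat \<Rightarrow> int \<Rightarrow> int \<Rightarrow> 'k::field mat" where
  "matrix_unit F l a b =
    mat (dimn F l) (dimn F l) (\<lambda>(r, c). if r = pos F l a \<and> c = pos F l b then 1 else 0)"

fun form :: "family \<Rightarrow> nat \<Rightarrow> 'k::field mat" where
  "form Symplectic l = four_block_mat (0\<^sub>m l l) (1\<^sub>m l) (- 1\<^sub>m l) (0\<^sub>m l l)"
| "form Even_Orthogonal l = four_block_mat (0\<^sub>m l l) (1\<^sub>m l) (1\<^sub>m l) (0\<^sub>m l l)"
| "form Odd_Orthogonal l =
    four_block_mat (2 \<cdot>\<^sub>m 1\<^sub>m 1) (0\<^sub>m 1 (2 * l)) (0\<^sub>m (2 * l) 1)
      (four_block_mat (0\<^sub>m l l) (1\<^sub>m l) (1\<^sub>m l) (0\<^sub>m l l))"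

definition isometry_group :: "family \<Rightarrow> nat \<Rightarrow> 'k::field mat set" where
  "isometry_group F l =
    {g \<in> carrier_mat (dimn F l) (dimn F l).
       invertible_mat g \<and> transpose_mat g * form F l * g = form F l}"

definition siegel_space :: "family \<Rightarrow> nat \<Rightarrow> 'k::field vec set" where
  "siegel_space F l =
    LinearCombinations.module.span class_ring (module_vec TYPE('k) (dimn F l))
      {basis_vec F l a | a. 1 \<le> a \<and> a \<le> int l}"

definition siegel_parabolic :: "family \<Rightarrow> nat \<Rightarrow> 'k::field mat set" where
  "siegel_parabolic F l =
    {g \<in> isometry_group F l. (\<lambda>v. g *\<^sub>v v) ` siegel_space F l = siegel_space F l}"

fun w_elt :: "family \<Rightarrow> nat \<Rightarrow> int \<Rightarrow> 'k::field mat" where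
  "w_elt Symplectic l i =
    (let I = 1\<^sub>m (dimn Symplectic l); e = matrix_unit Symplectic l in
     I - e i i - e (- i) (- i) + e i (- i) - e (- i) i)"
| "w_elt Even_Orthogonal l i =
    (let I = 1\<^sub>m (dimn Even_Orthogonal l); e = matrix_unit Even_Orthogonal l in
     I - e i i - e (- i) (- i) + e i (- i) + e (- i) i)"
| "w_elt Odd_Orthogonal l i =
    (let I = 1\<^sub>m (dimn Odd_Orthogonal l); e = matrix_unit Odd_Orthogonal l in
     I - 2 \<cdot>\<^sub>m e 0 0 - e i i - e (- i) (- i) - e i (- i) - e (- i) i)"

fun omega :: "family \<Rightarrow> nat \<Rightarrow> nat \<Rightarrow> 'k::field mat" where
  "omega F l 0 = 1\<^sub>m (dimn F l)"
| "omega F l (Suc i) = omega F l i * w_elt F l (int (Suc i))"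

definition W_hat :: "family \<Rightarrow> nat \<Rightarrow> 'k::field mat set" where
  "W_hat F l = {omega F l i | i. i \<le> l}"

definition double_coset :: "'k::field mat set \<Rightarrow> 'k mat \<Rightarrow> 'k mat set" where
  "double_coset P x = {p * x * q | p q. p \<in> P \<and> q \<in> P}"

section \<open>Algorithms over a field\<close>

text \<open>An algorithm is a program for a random access machine over the field \<open>k\<close>: finitely many
  registers hold natural numbers, and a two-dimensional array of cells, addressed through the
  registers, holds elements of \<open>k\<close>. The only access to \<open>k\<close> is by the constants 0 and 1, the four
  field operations and zero tests, so the program text depends neither on the field nor on the rank.
  Register arithmetic has no multiplication, so that within a given number of steps the registers
  cannot grow faster than on a standard unit-cost random access machine.\<close>

datatype aexp = Num nat | Reg nat | Plus aexp aexp | Minus aexp aexp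

datatype loc = Cell aexp aexp

datatype field_op = Add | Sub | Mul | Div

datatype fexp = Zero | One | Op field_op loc loc

datatype test = Less aexp aexp | Is_Zero loc

datatype prog =
    Skip
  | Set_Reg nat aexp
  | Set_Cell loc fexp
  | Seq prog prog
  | If test prog prog
  | While test prog

type_synonym regs = "nat \<Rightarrow> nat"
type_synonym 'k cells = "nat \<times> nat \<Rightarrow> 'k"
type_synonym 'k state = "regs \<times> 'k cells"

fun aval :: "regs \<Rightarrow> aexp \<Rightarrow> nat" where
  "aval R (Num n) = n"
| "aval R (Reg x) = R x"
| "aval R (Plus a b) = aval R a + aval R b"
| "aval R (Minus a b) = aval R a - aval R b"

fun addr :: "regs \<Rightarrow> loc \<Rightarrow> nat \<times> nat" where
  "addr R (Cell a b) = (aval R a, aval R b)"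

text \<open>Division by zero has no value: the program gets stuck there.\<close>

fun apply_op :: "field_op \<Rightarrow> 'k::field \<Rightarrow> 'k \<Rightarrow> 'k option" where
  "apply_op Add x y = Some (x + y)"
| "apply_op Sub x y = Some (x - y)"
| "apply_op Mul x y = Some (x * y)"
| "apply_op Div x y = (if y = 0 then None else Some (x / y))"

fun fval :: "'k::field state \<Rightarrow> fexp \<Rightarrow> 'k option" where
  "fval s Zero = Some 0"
| "fval s One = Some 1"
| "fval (R, M) (Op f u v) = apply_op f (M (addr R u)) (M (addr R v))"

fun holds :: "'k::field state \<Rightarrow> test \<Rightarrow> bool" where
  "holds (R, M) (Less a b) \<longleftrightarrow> aval R a < aval R b"
| "holds (R, M) (Is_Zero u) \<longleftrightarrow> M (addr R u) = 0"

text \<open>\<open>exec c s n t\<close>: started in \<open>s\<close>, the program \<open>c\<close> halts in \<open>t\<close> after \<open>n\<close> steps. Every assignment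
  and every test is one step, so \<open>n\<close> bounds the number of operations in \<open>k\<close>.\<close>

inductive exec :: "prog \<Rightarrow> 'k::field state \<Rightarrow> nat \<Rightarrow> 'k state \<Rightarrow> bool" where
  Skip: "exec Skip s 0 s"
| Set_Reg: "exec (Set_Reg x a) (R, M) 1 (R(x := aval R a), M)"
| Set_Cell: "fval (R, M) e = Some v \<Longrightarrow> exec (Set_Cell u e) (R, M) 1 (R, M(addr R u := v))"
| Seq: "exec c s m s' \<Longrightarrow> exec d s' n s'' \<Longrightarrow> exec (Seq c d) s (m + n) s''"
| If_True: "holds s b \<Longrightarrow> exec c s n t \<Longrightarrow> exec (If b c d) s (Suc n) t"
| If_False: "\<not> holds s b \<Longrightarrow> exec d s n t \<Longrightarrow> exec (If b c d) s (Suc n) t"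
| While_False: "\<not> holds s b \<Longrightarrow> exec (While b c) s 1 s"
| While_True: "holds s b \<Longrightarrow> exec c s m s' \<Longrightarrow> exec (While b c) s' n s'' \<Longrightarrow>
    exec (While b c) s (Suc (m + n)) s''"

inductive_cases exec_SkipE: "exec Skip s n t"
inductive_cases exec_Set_RegE: "exec (Set_Reg x a) s n t"
inductive_cases exec_Set_CellE: "exec (Set_Cell u e) s n t"
inductive_cases exec_SeqE: "exec (Seq c d) s n t"
inductive_cases exec_IfE: "exec (If b c d) s n t"
inductive_cases exec_WhileE: "exec (While b c) s n t"

lemma exec_deterministic: "exec c s n t \<Longrightarrow> exec c s n' t' \<Longrightarrow> n = n' \<and> t = t'"
proof (induction arbitrary: n' t' rule: exec.induct)
  case Skip
  then show ?case by (auto elim: exec_SkipE)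
next
  case Set_Reg
  then show ?case by (auto elim: exec_Set_RegE)
next
  case Set_Cell
  then show ?case by (auto elim!: exec_Set_CellE)
next
  case (Seq c s m s' d n s'')
  from Seq.prems show ?case by (rule exec_SeqE) (metis Seq.IH)
next
  case (If_True s b c n t d)
  from If_True.prems show ?case by (rule exec_IfE) (metis If_True.hyps(1) If_True.IH)+
next
  case (If_False s b d n t c)
  from If_False.prems show ?case by (rule exec_IfE) (metis If_False.hyps(1) If_False.IH)+
next
  case (While_False s b c)
  from While_False.prems show ?case by (rule exec_WhileE) (use While_False.hyps(1) in auto)
next
  case (While_True s b c m s' n s'')
  from While_True.prems show ?case by (rule exec_WhileE) (metis While_True.hyps(1) While_True.IH)+
qed

text \<open>Input: register 0 holds the rank \<open>l\<close> and the cells hold the entries of \<open>g\<close>; everything else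
  is 0.\<close>

definition input :: "nat \<Rightarrow> 'k::field mat \<Rightarrow> 'k state" where
  "input l g =
    ((\<lambda>_. 0)(0 := l), \<lambda>(i, j). if i < dim_row g \<and> j < dim_col g then g $$ (i, j) else 0)"

text \<open>Output: an element of \<^term>\<open>W_hat F l\<close> is returned as its index in the list
  \<open>\<omega>\<^sub>0, \<dots>, \<omega>\<^sub>l\<close>, left in register 0.\<close>

definition determines :: "prog \<Rightarrow> family \<Rightarrow> nat \<Rightarrow> 'k::field mat \<Rightarrow> nat \<Rightarrow> 'k mat \<Rightarrow> bool" where
  "determines c F l g n \<omega> \<longleftrightarrow>
    (\<exists>R M. exec c (input l g) n (R, M) \<and> R 0 \<le> l \<and> \<omega> = omega F l (R 0))"

end

theory Submission
  imports Defs
begin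

text \<open>The double coset \<open>P g P\<close> is determined by the rank \<open>r\<close> of the lower left \<open>l \<times> l\<close> block \<open>C\<close> of \<open>g\<close>.
  Levi factors act on \<open>C\<close> by two-sided equivalence, so \<open>C\<close> may be taken to be \<open>diag(I\<^sub>r, 0)\<close>; the
  isometry relations then force the shape of the remaining blocks in the first \<open>l\<close> columns closely
  enough that an explicit unipotent \<open>u \<in> P\<close> makes \<open>\<omega>\<^sub>r\<^sup>-\<^sup>1 u g\<close> stabilize the isotropic space. The rank is
  computed by Wedderburn rank reduction: whenever an entry \<open>C\<^sub>i\<^sub>j\<close> is nonzero, subtracting
  \<open>C e\<^sub>j e\<^sub>i\<^sup>T C / C\<^sub>i\<^sub>j\<close> lowers the rank by one and clears row \<open>i\<close> and column \<open>j\<close>, so one pass over all positions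
  reaches the zero matrix.\<close>

section \<open>Block matrices\<close>

text \<open>The odd orthogonal case shapes the argument: there g has an extra row y over the columns
  1, ..., l, which the Levi factors used here cannot remove. It is controlled by the middle block of
  the isometry relation, 2 y^T y + A^T C + \<epsilon> C^T A = 0. For C = diag(I_r, 0) the diagonal
  of this relation beyond r reads 2 y_j^2 = 0, and 2 is nonzero, so y lives in the first r columns.
  The same relation then kills the upper right r x (l - r) part of A, and on the first r indices it
  is exactly the symmetry that lets u be an isometry. Rank enters only through explicit equivalences
  C = X diag(I_r, 0) Y with invertible X and Y. The Wedderburn steps produce X and Y, and these
  become the Levi factors. Reaching every element of \<open>W_hat\<close> needs one more fact: on
  input \<omega>_r the program must return r itself, so diag(I_r, 0) and diag(I_s, 0) must not be
  equivalent for r different from s. A determinant argument gives this.\<close>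

text \<open>With a leading block of size \<open>m = 1\<close> in the odd orthogonal case and \<open>m = 0\<close> otherwise, all three
  families share one block form of sizes \<open>m, l, l\<close>.\<close>

definition blk :: "nat \<Rightarrow> nat \<Rightarrow> 'k::field mat \<Rightarrow> 'k mat \<Rightarrow> 'k mat \<Rightarrow> 'k mat \<Rightarrow> 'k mat \<Rightarrow> 'k mat \<Rightarrow>
    'k mat \<Rightarrow> 'k mat \<Rightarrow> 'k mat \<Rightarrow> 'k mat" where
  "blk m l a y z E A B F C D = mat (m + 2 * l) (m + 2 * l) (\<lambda>(i, j).
     if i < m then (if j < m then a $$ (i, j) else if j < m + l then y $$ (i, j - m) else z $$ (i, j - m - l))
     else if i < m + l then (if j < m then E $$ (i - m, j) else if j < m + l then A $$ (i - m, j - m)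
       else B $$ (i - m, j - m - l))
     else (if j < m then F $$ (i - m - l, j) else if j < m + l then C $$ (i - m - l, j - m)
       else D $$ (i - m - l, j - m - l)))"

lemma blk_carrier [simp]: "blk m l a y z E A B F C D \<in> carrier_mat (m + 2 * l) (m + 2 * l)"
  by (simp add: blk_def)

lemma blk_dim [simp]:
  "dim_row (blk m l a y z E A B F C D) = m + 2 * l" "dim_col (blk m l a y z E A B F C D) = m + 2 * l"
  by (simp_all add: blk_def)

lemma transpose_blk:
  assumes "a \<in> carrier_mat m m" "y \<in> carrier_mat m l" "z \<in> carrier_mat m l"
    "E \<in> carrier_mat l m" "A \<in> carrier_mat l l" "B \<in> carrier_mat l l"
    "F \<in> carrier_mat l m" "C \<in> carrier_mat l l" "D \<in> carrier_mat l l"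
  shows "transpose_mat (blk m l a y z E A B F C D) =
    blk m l (transpose_mat a) (transpose_mat E) (transpose_mat F) (transpose_mat y) (transpose_mat A)
      (transpose_mat C) (transpose_mat z) (transpose_mat B) (transpose_mat D)"
  by (rule eq_matI) (use assms in \<open>auto simp: blk_def\<close>)

lemma sum_three_blocks:
  "(\<Sum>k<m + 2 * l. f k) = (\<Sum>k<m. f k) + (\<Sum>k<l. f (m + k)) + (\<Sum>k<l. f (m + l + k :: nat) :: 'a::comm_monoid_add)"
proof -
  have *: "(\<Sum>k<p + q. f k) = (\<Sum>k<p. f k) + (\<Sum>k<q. f (p + k))" for p q
    by (induction q) (auto simp: algebra_simps)
  have "m + 2 * l = (m + l) + l" by simp
  then show ?thesis by (simp only: *)
qed

lemma blk_mult:
  assumes "a \<in> carrier_mat m m" "y \<in> carrier_mat m l" "z \<in> carrier_mat m l"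
    "E \<in> carrier_mat l m" "A \<in> carrier_mat l l" "B \<in> carrier_mat l l"
    "F \<in> carrier_mat l m" "C \<in> carrier_mat l l" "D \<in> carrier_mat l l"
    "a' \<in> carrier_mat m m" "y' \<in> carrier_mat m l" "z' \<in> carrier_mat m l"
    "E' \<in> carrier_mat l m" "A' \<in> carrier_mat l l" "B' \<in> carrier_mat l l"
    "F' \<in> carrier_mat l m" "C' \<in> carrier_mat l l" "D' \<in> carrier_mat l l"
  shows "blk m l a y z E A B F C D * blk m l a' y' z' E' A' B' F' C' D' =
    blk m l (a * a' + y * E' + z * F') (a * y' + y * A' + z * C') (a * z' + y * B' + z * D')
      (E * a' + A * E' + B * F') (E * y' + A * A' + B * C') (E * z' + A * B' + B * D')
      (F * a' + C * E' + D * F') (F * y' + C * A' + D * C') (F * z' + C * B' + D * D')"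
  (is "?L = ?R")
proof (rule eq_matI)
  fix i j assume "i < dim_row ?R" "j < dim_col ?R"
  then have ij: "i < m + 2 * l" "j < m + 2 * l" by (simp_all add: blk_def)
  have "?L $$ (i, j) = (\<Sum>k<m + 2 * l. blk m l a y z E A B F C D $$ (i, k) * blk m l a' y' z' E' A' B' F' C' D' $$ (k, j))"
    using ij by (simp add: scalar_prod_def atLeast0LessThan)
  also have "\<dots> = ?R $$ (i, j)"
    unfolding sum_three_blocks using ij assms
    by (auto simp: blk_def scalar_prod_def atLeast0LessThan)
  finally show "?L $$ (i, j) = ?R $$ (i, j)" .
qed (simp_all)

lemma blk_inject:
  assumes eq: "blk m l a y z E A B F C D = blk m l a' y' z' E' A' B' F' C' D'"
    and "A \<in> carrier_mat l l" "B \<in> carrier_mat l l" "A' \<in> carrier_mat l l" "B' \<in> carrier_mat l l"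
  shows "A = A'" "B = B'"
proof -
  have *: "blk m l a y z E A B F C D $$ (i, j) = blk m l a' y' z' E' A' B' F' C' D' $$ (i, j)" for i j
    using eq by simp
  show "A = A'"
  proof (rule eq_matI)
    fix i j assume "i < dim_row A'" "j < dim_col A'"
    then show "A $$ (i, j) = A' $$ (i, j)" using *[of "m + i" "m + j"] assms(2-) by (simp add: blk_def)
  qed (use assms in auto)
  show "B = B'"
  proof (rule eq_matI)
    fix i j assume "i < dim_row B'" "j < dim_col B'"
    then show "B $$ (i, j) = B' $$ (i, j)" using *[of "m + i" "m + l + j"] assms(2-) by (simp add: blk_def)
  qed (use assms in auto)
qed

lemma blk_cases:
  assumes "g \<in> carrier_mat (m + 2 * l) (m + 2 * l)"
  obtains a y z E A B F C D where "g = blk m l a y z E A B F C D"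
    "a \<in> carrier_mat m m" "y \<in> carrier_mat m l" "z \<in> carrier_mat m l"
    "E \<in> carrier_mat l m" "A \<in> carrier_mat l l" "B \<in> carrier_mat l l"
    "F \<in> carrier_mat l m" "C \<in> carrier_mat l l" "D \<in> carrier_mat l l"
    "C = mat l l (\<lambda>(i, j). g $$ (m + l + i, m + j))"
proof
  let ?b = "\<lambda>p q s t. mat p q (\<lambda>(i, j). g $$ (s + i, t + j))"
  show "g = blk m l (?b m m 0 0) (?b m l 0 m) (?b m l 0 (m + l)) (?b l m m 0) (?b l l m m) (?b l l m (m + l))
     (?b l m (m + l) 0) (?b l l (m + l) m) (?b l l (m + l) (m + l))"
    by (rule eq_matI) (use assms in \<open>auto simp: blk_def\<close>)
qed auto

section \<open>Isometry groups and the Siegel parabolic\<close>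

definition mid :: "family \<Rightarrow> nat" where
  "mid F = (if F = Odd_Orthogonal then 1 else 0)"

text \<open>The sign \<epsilon> for which the transpose of the form is \<epsilon> times the
  form.\<close>

definition form_sign :: "family \<Rightarrow> 'k::field" where
  "form_sign F = (if F = Symplectic then - 1 else 1)"

lemma dimn_eq: "dimn F l = mid F + 2 * l"
  by (cases F) (simp_all add: mid_def)

lemma form_eq_blk:
  "form F l = blk (mid F) l (2 \<cdot>\<^sub>m 1\<^sub>m (mid F)) (0\<^sub>m (mid F) l) (0\<^sub>m (mid F) l)
     (0\<^sub>m l (mid F)) (0\<^sub>m l l) (1\<^sub>m l) (0\<^sub>m l (mid F)) (form_sign F \<cdot>\<^sub>m 1\<^sub>m l) (0\<^sub>m l l)"
proof (cases F)
  case Symplectic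
  show ?thesis
    by (rule eq_matI) (auto simp: Symplectic mid_def blk_def form_sign_def)
next
  case Even_Orthogonal
  show ?thesis
    by (rule eq_matI) (auto simp: Even_Orthogonal mid_def blk_def form_sign_def)
next
  case Odd_Orthogonal
  show ?thesis
    by (rule eq_matI) (auto simp: Odd_Orthogonal mid_def blk_def form_sign_def)
qed

lemma form_carrier [simp]: "form F l \<in> carrier_mat (dimn F l) (dimn F l)"
  by (simp add: form_eq_blk dimn_eq)

lemma form_sign_square [simp]: "form_sign F * form_sign F = 1"
  by (simp add: form_sign_def)

lemma square_mat_mult: "A \<in> carrier_mat n n \<Longrightarrow> B \<in> carrier_mat n n \<Longrightarrow> A * B \<in> carrier_mat n n"
  by simp

lemma square_mat_assoc:
  "A \<in> carrier_mat n n \<Longrightarrow> B \<in> carrier_mat n n \<Longrightarrow> C \<in> carrier_mat n n \<Longrightarrow> (A * B) * C = A * (B * C)"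
  by (rule assoc_mult_mat)

lemma form_left_inverse:
  assumes "(2 :: 'k::field) \<noteq> 0"
  obtains H :: "'k::field mat" where "H \<in> carrier_mat (dimn F l) (dimn F l)" "H * form F l = 1\<^sub>m (dimn F l)"
proof
  let ?m = "mid F"
  let ?H = "blk ?m l ((1 / 2) \<cdot>\<^sub>m 1\<^sub>m ?m) (0\<^sub>m ?m l) (0\<^sub>m ?m l)
     (0\<^sub>m l ?m) (0\<^sub>m l l) (form_sign F \<cdot>\<^sub>m 1\<^sub>m l) (0\<^sub>m l ?m) (1\<^sub>m l) (0\<^sub>m l l) :: 'k mat"
  show "?H \<in> carrier_mat (dimn F l) (dimn F l)" by (simp add: dimn_eq)
  show "?H * form F l = 1\<^sub>m (dimn F l)"
    unfolding form_eq_blk dimn_eq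
    by (subst blk_mult; (simp; fail)?) (rule eq_matI, use assms in \<open>auto simp: blk_def\<close>)
qed

text \<open>Preserving a nondegenerate form already forces invertibility: if H inverts the form,
  then \<open>H * transpose_mat g * form F l\<close> is a left inverse of g, and for square matrices
  a left inverse is two-sided.\<close>

lemma isometry_groupI:
  fixes g :: "'k::field mat"
  assumes two: "(2 :: 'k) \<noteq> 0" and g: "g \<in> carrier_mat (dimn F l) (dimn F l)"
    and eq: "transpose_mat g * form F l * g = form F l"
  shows "g \<in> isometry_group F l"
proof -
  obtain H :: "'k mat" where H: "H \<in> carrier_mat (dimn F l) (dimn F l)" "H * form F l = 1\<^sub>m (dimn F l)"
    using form_left_inverse[OF two] .
  let ?h = "H * transpose_mat g * form F l"
  have h: "?h \<in> carrier_mat (dimn F l) (dimn F l)"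
    using H g by (simp add: square_mat_mult[of _ "dimn F l"])
  have "?h * g = H * (transpose_mat g * form F l * g)"
    using H(1) g by (simp add: square_mat_assoc[of _ "dimn F l"] square_mat_mult[of _ "dimn F l"])
  then have hg: "?h * g = 1\<^sub>m (dimn F l)" using eq H(2) by simp
  have gh: "g * ?h = 1\<^sub>m (dimn F l)" by (rule mat_mult_left_right_inverse[OF h g hg])
  have "invertible_mat g"
    unfolding invertible_mat_def inverts_mat_def using g h hg gh by (intro conjI exI[of _ ?h]) auto
  then show ?thesis using g eq by (simp add: isometry_group_def)
qed

section \<open>Products and inverses of isometries\<close>

lemma isometry_group_carrier: "g \<in> isometry_group F l \<Longrightarrow> g \<in> carrier_mat (dimn F l) (dimn F l)"
  by (simp add: isometry_group_def)

lemma isometry_group_mult: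
  fixes g :: "'k::field mat"
  assumes two: "(2 :: 'k) \<noteq> 0" and g: "g \<in> isometry_group F l" and h: "h \<in> isometry_group F l"
  shows "g * h \<in> isometry_group F l"
proof (rule isometry_groupI[OF two])
  note gc = isometry_group_carrier[OF g] and hc = isometry_group_carrier[OF h]
  show "g * h \<in> carrier_mat (dimn F l) (dimn F l)" using gc hc by simp
  have "transpose_mat (g * h) * form F l * (g * h)
      = transpose_mat h * (transpose_mat g * form F l * g) * h"
    using gc hc
    by (simp add: transpose_mult square_mat_assoc[of _ "dimn F l"] square_mat_mult[of _ "dimn F l"])
  then show "transpose_mat (g * h) * form F l * (g * h) = form F l"
    using g h by (simp add: isometry_group_def)
qed

lemma isometry_group_inverse:
  fixes g :: "'k::field mat"
  assumes two: "(2 :: 'k) \<noteq> 0" and g: "g \<in> isometry_group F l"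
  obtains h where "h \<in> isometry_group F l" "g * h = 1\<^sub>m (dimn F l)" "h * g = 1\<^sub>m (dimn F l)"
proof -
  note gc = isometry_group_carrier[OF g]
  let ?n = "dimn F l"
  from g obtain h where h: "g * h = 1\<^sub>m ?n" "h * g = 1\<^sub>m (dim_row h)"
    unfolding isometry_group_def invertible_mat_def inverts_mat_def by auto
  \<comment> \<open>\<open>invertible_mat\<close> does not fix the size of the inverse; it is read
    off from the two identities.\<close>
  have "dim_col h = ?n" using arg_cong[OF h(1), of dim_col] by simp
  moreover have "dim_row h = ?n" using arg_cong[OF h(2), of dim_col] gc by simp
  ultimately have hc: "h \<in> carrier_mat ?n ?n" by auto
  have hg: "h * g = 1\<^sub>m ?n" using h(2) hc by simp
  have "transpose_mat h * form F l * h = transpose_mat h * (transpose_mat g * form F l * g) * h"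
    using g by (simp add: isometry_group_def)
  also have "\<dots> = transpose_mat (g * h) * form F l * (g * h)"
    using gc hc
    by (simp add: transpose_mult square_mat_assoc[of _ "dimn F l"] square_mat_mult[of _ "dimn F l"])
  also have "\<dots> = form F l" using h(1)
    by (simp add: left_mult_one_mat[OF form_carrier] right_mult_one_mat[OF form_carrier])
  finally have "h \<in> isometry_group F l" by (rule isometry_groupI[OF two hc])
  then show ?thesis using h(1) hg by (rule that)
qed

text \<open>Its columns are e_1, ..., e_l. With the Siegel space as its column space, stability
  under g becomes the matrix identity \<open>g * siegel_incl m l = siegel_incl m l * A\<close> with
  A invertible.\<close>

definition siegel_incl :: "nat \<Rightarrow> nat \<Rightarrow> 'k::field mat" where
  "siegel_incl m l = mat (m + 2 * l) l (\<lambda>(i, j). if i = m + j then 1 else 0)"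

lemma siegel_incl_carrier [simp]: "siegel_incl m l \<in> carrier_mat (m + 2 * l) l"
  by (simp add: siegel_incl_def)

lemma siegel_space_eq:
  "(siegel_space F l :: 'k::field vec set) = (\<lambda>x. siegel_incl (mid F) l *\<^sub>v x) ` carrier_vec l"
proof -
  let ?n = "dimn F l"
  let ?vs = "map (\<lambda>j. unit_vec ?n (mid F + j)) [0..<l] :: 'k vec list"
  interpret vec_space "TYPE('k)" ?n .
  have vs: "set ?vs \<subseteq> carrier_vec ?n" by auto
  have "{basis_vec F l a | a. 1 \<le> a \<and> a \<le> int l} = set ?vs"
  proof
    show "set ?vs \<subseteq> {basis_vec F l a | a. 1 \<le> a \<and> a \<le> int l}"
    proof
      fix v assume "v \<in> set ?vs"
      then obtain j where "j < l" "v = unit_vec ?n (mid F + j)" by auto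
      then show "v \<in> {basis_vec F l a | a. 1 \<le> a \<and> a \<le> int l}"
        by (intro CollectI exI[of _ "int j + 1"]) (auto simp: basis_vec_def pos_def mid_def nat_add_distrib)
    qed
    show "{basis_vec F l a | a. 1 \<le> a \<and> a \<le> int l} \<subseteq> set ?vs"
    proof
      fix v :: "'k vec" assume "v \<in> {basis_vec F l a | a. 1 \<le> a \<and> a \<le> int l}"
      then obtain a where a: "1 \<le> a" "a \<le> int l" "v = basis_vec F l a" by auto
      then have "v = unit_vec ?n (mid F + (nat a - 1))" "nat a - 1 < l"
        by (auto simp: basis_vec_def pos_def mid_def)
      then show "v \<in> set ?vs" by auto
    qed
  qed
  then have "siegel_space F l = span_list ?vs"
    unfolding siegel_space_def span_list_as_span[OF vs] by simp
  moreover have "mat_of_cols ?n ?vs = siegel_incl (mid F) l"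
    by (rule eq_matI) (auto simp: siegel_incl_def mat_of_cols_def dimn_eq)
  then have *: "lincomb_list c ?vs = siegel_incl (mid F) l *\<^sub>v vec l c" for c
    using lincomb_list_as_mat_mult[of ?vs c] vs by simp
  have "span_list ?vs = (\<lambda>x. siegel_incl (mid F) l *\<^sub>v x) ` carrier_vec l"
  proof
    show "span_list ?vs \<subseteq> (\<lambda>x. siegel_incl (mid F) l *\<^sub>v x) ` carrier_vec l"
      unfolding span_list_def * by auto
    show "(\<lambda>x. siegel_incl (mid F) l *\<^sub>v x) ` carrier_vec l \<subseteq> span_list ?vs"
    proof clarify
      fix x :: "'k vec" assume x: "x \<in> carrier_vec l"
      then have "x = vec l (($) x)" by auto
      then have "siegel_incl (mid F) l *\<^sub>v x = lincomb_list (($) x) ?vs" unfolding * by simp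
      then show "siegel_incl (mid F) l *\<^sub>v x \<in> span_list ?vs" unfolding span_list_def
        by auto
    qed
  qed
  ultimately show ?thesis by simp
qed

section \<open>The isometry relation in block form\<close>

lemma mult_smult_right: "dim_col A = dim_row B \<Longrightarrow> A * (k \<cdot>\<^sub>m B) = k \<cdot>\<^sub>m (A * B :: 'a::comm_ring_1 mat)"
  by (rule mult_smult_distrib[of _ "dim_row A" "dim_row B" _ "dim_col B"]) auto

lemma smult_one_mult: "dim_row A = n \<Longrightarrow> (k \<cdot>\<^sub>m 1\<^sub>m n) * A = k \<cdot>\<^sub>m (A :: 'a::comm_ring_1 mat)"
  by (subst mult_smult_assoc_mat[of _ n n _ "dim_col A"]) auto

text \<open>The expansion is used in both directions: to extract relations from a given isometry,
  and to verify that the explicit matrices (the unipotent, the Levi elements, the \<omega>_r) are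
  isometries.\<close>

lemma blk_congruence_form:
  fixes a :: "'k::field mat" and F :: family
  defines "\<epsilon> \<equiv> form_sign F :: 'k"
  assumes m: "m = mid F" and c: "a \<in> carrier_mat m m" "y \<in> carrier_mat m l" "z \<in> carrier_mat m l"
    "E \<in> carrier_mat l m" "A \<in> carrier_mat l l" "B \<in> carrier_mat l l"
    "H \<in> carrier_mat l m" "C \<in> carrier_mat l l" "D \<in> carrier_mat l l"
  shows "transpose_mat (blk m l a y z E A B H C D) * form F l * blk m l a y z E A B H C D =
    blk m l
     (2 \<cdot>\<^sub>m (transpose_mat a * a) + transpose_mat E * H + \<epsilon> \<cdot>\<^sub>m (transpose_mat H * E))
     (2 \<cdot>\<^sub>m (transpose_mat a * y) + transpose_mat E * C + \<epsilon> \<cdot>\<^sub>m (transpose_mat H * A))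
     (2 \<cdot>\<^sub>m (transpose_mat a * z) + transpose_mat E * D + \<epsilon> \<cdot>\<^sub>m (transpose_mat H * B))
     (2 \<cdot>\<^sub>m (transpose_mat y * a) + transpose_mat A * H + \<epsilon> \<cdot>\<^sub>m (transpose_mat C * E))
     (2 \<cdot>\<^sub>m (transpose_mat y * y) + transpose_mat A * C + \<epsilon> \<cdot>\<^sub>m (transpose_mat C * A))
     (2 \<cdot>\<^sub>m (transpose_mat y * z) + transpose_mat A * D + \<epsilon> \<cdot>\<^sub>m (transpose_mat C * B))
     (2 \<cdot>\<^sub>m (transpose_mat z * a) + transpose_mat B * H + \<epsilon> \<cdot>\<^sub>m (transpose_mat D * E))
     (2 \<cdot>\<^sub>m (transpose_mat z * y) + transpose_mat B * C + \<epsilon> \<cdot>\<^sub>m (transpose_mat D * A))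
     (2 \<cdot>\<^sub>m (transpose_mat z * z) + transpose_mat B * D + \<epsilon> \<cdot>\<^sub>m (transpose_mat D * B))"
proof -
  let ?g = "blk m l a y z E A B H C D"
  \<comment> \<open>Left multiplication by the form doubles the leading block row and exchanges the
    other two, with the sign \<epsilon> on the one that moves down.\<close>
  have "form F l * ?g = blk m l (2 \<cdot>\<^sub>m a) (2 \<cdot>\<^sub>m y) (2 \<cdot>\<^sub>m z) H C D (\<epsilon> \<cdot>\<^sub>m E) (\<epsilon> \<cdot>\<^sub>m A) (\<epsilon> \<cdot>\<^sub>m B)"
    unfolding form_eq_blk m[symmetric] \<epsilon>_def
    by (subst blk_mult; (use c in \<open>simp; fail\<close>)?)
      (use c in \<open>simp add: smult_one_mult[of _ m] smult_one_mult[of _ l]\<close>)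
  moreover have "transpose_mat ?g * form F l * ?g = transpose_mat ?g * (form F l * ?g)"
    using form_carrier[of F l] by (intro square_mat_assoc[of _ "m + 2 * l"]) (auto simp: dimn_eq m)
  moreover have "transpose_mat ?g = blk m l (transpose_mat a) (transpose_mat E) (transpose_mat H) (transpose_mat y) (transpose_mat A)
      (transpose_mat C) (transpose_mat z) (transpose_mat B) (transpose_mat D)"
    by (rule transpose_blk) (use c in auto)
  ultimately have "transpose_mat ?g * form F l * ?g =
    blk m l (transpose_mat a) (transpose_mat E) (transpose_mat H) (transpose_mat y) (transpose_mat A)
      (transpose_mat C) (transpose_mat z) (transpose_mat B) (transpose_mat D) *
    blk m l (2 \<cdot>\<^sub>m a) (2 \<cdot>\<^sub>m y) (2 \<cdot>\<^sub>m z) H C D (\<epsilon> \<cdot>\<^sub>m E) (\<epsilon> \<cdot>\<^sub>m A) (\<epsilon> \<cdot>\<^sub>m B)"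
    by (simp only:)
  then show ?thesis
    by (subst (asm) blk_mult; (use c in \<open>simp; fail\<close>)?)
      (simp only: mult_smult_right index_transpose_mat carrier_matD[OF c(1)] carrier_matD[OF c(2)] carrier_matD[OF c(3)]
       carrier_matD[OF c(4)] carrier_matD[OF c(5)] carrier_matD[OF c(6)] carrier_matD[OF c(7)] carrier_matD[OF c(8)]
       carrier_matD[OF c(9)])
qed

lemma isometry_group_blocks:
  fixes a :: "'k::field mat"
  assumes g: "blk m l a y z E A B H C D \<in> isometry_group F l"
    and m: "m = mid F" and c: "a \<in> carrier_mat m m" "y \<in> carrier_mat m l" "z \<in> carrier_mat m l"
    "E \<in> carrier_mat l m" "A \<in> carrier_mat l l" "B \<in> carrier_mat l l"
    "H \<in> carrier_mat l m" "C \<in> carrier_mat l l" "D \<in> carrier_mat l l"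
  shows "2 \<cdot>\<^sub>m (transpose_mat y * y) + transpose_mat A * C + form_sign F \<cdot>\<^sub>m (transpose_mat C * A) = 0\<^sub>m l l"
    and "2 \<cdot>\<^sub>m (transpose_mat y * z) + transpose_mat A * D + form_sign F \<cdot>\<^sub>m (transpose_mat C * B) = 1\<^sub>m l"
proof -
  from g have "transpose_mat (blk m l a y z E A B H C D) * form F l * blk m l a y z E A B H C D = form F l"
    by (simp add: isometry_group_def)
  note * = this[unfolded blk_congruence_form[OF m c], unfolded form_eq_blk m[symmetric]]
  show "2 \<cdot>\<^sub>m (transpose_mat y * y) + transpose_mat A * C + form_sign F \<cdot>\<^sub>m (transpose_mat C * A) = 0\<^sub>m l l"
    by (rule blk_inject(1)[OF *]) (use c in auto)
  show "2 \<cdot>\<^sub>m (transpose_mat y * z) + transpose_mat A * D + form_sign F \<cdot>\<^sub>m (transpose_mat C * B) = 1\<^sub>m l"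
    by (rule blk_inject(2)[OF *]) (use c in auto)
qed

text \<open>With y = 0 and C = 0 the second block relation collapses to A^T D = 1. Hence A is
  invertible with inverse D^T, and g maps the Siegel space onto itself and not merely into
  itself.\<close>

lemma siegel_parabolicI:
  fixes a :: "'k::field mat"
  assumes g: "g \<in> isometry_group F l" "g = blk m l a (0\<^sub>m m l) z E A B H (0\<^sub>m l l) D"
    and m: "m = mid F" and c: "a \<in> carrier_mat m m" "z \<in> carrier_mat m l"
    "E \<in> carrier_mat l m" "A \<in> carrier_mat l l" "B \<in> carrier_mat l l"
    "H \<in> carrier_mat l m" "D \<in> carrier_mat l l"
  shows "g \<in> siegel_parabolic F l"
proof -
  let ?i = "siegel_incl m l :: 'k mat"
  have "2 \<cdot>\<^sub>m (transpose_mat (0\<^sub>m m l) * z) + transpose_mat A * D + form_sign F \<cdot>\<^sub>m (transpose_mat (0\<^sub>m l l) * B) = 1\<^sub>m l"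
    by (rule isometry_group_blocks(2)[OF g(1)[unfolded g(2)] m]) (use c in auto)
  then have AD: "transpose_mat A * D = 1\<^sub>m l"
    using c by (simp add: smult_zero_mat)
  then have "D * transpose_mat A = 1\<^sub>m l"
    using c by (intro mat_mult_left_right_inverse[of "transpose_mat A"]) auto
  then have "transpose_mat (D * transpose_mat A) = 1\<^sub>m l" by simp
  then have AD': "A * transpose_mat D = 1\<^sub>m l"
    using c by (simp add: transpose_mult[of D l l])
  have gc: "g \<in> carrier_mat (m + 2 * l) (m + 2 * l)" by (simp add: g(2))
  have gi: "g * ?i = ?i * A"
  proof (rule eq_matI)
    fix i j assume "i < dim_row (?i * A)" "j < dim_col (?i * A)"
    then have ij: "i < m + 2 * l" "j < l" using c by (auto simp: siegel_incl_def)
    have *: "g $$ (i, k) * (if k = m + j then 1 else 0) = (if k = m + j then g $$ (i, m + j) else 0)" for k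
      by simp
    have "(g * ?i) $$ (i, j) = g $$ (i, m + j)"
      using ij gc by (simp add: siegel_incl_def scalar_prod_def *)
    also have "g $$ (i, m + j) = (?i * A) $$ (i, j)"
    proof (cases "m \<le> i \<and> i < m + l")
      case True
      then have *: "(if i = m + k then 1 else 0) * A $$ (k, j) = (if k = i - m then A $$ (k, j) else 0)" for k by auto
      show ?thesis using ij c True
        by (auto simp: g(2) blk_def siegel_incl_def scalar_prod_def * sum.delta)
    next
      case False
      then have *: "(if i = m + k then 1 else 0) * A $$ (k, j) = 0" if "k < l" for k using that by auto
      show ?thesis using ij c False
        by (auto simp: g(2) blk_def siegel_incl_def scalar_prod_def * )
    qed
    finally show "(g * ?i) $$ (i, j) = (?i * A) $$ (i, j)" .
  qed (use c in \<open>auto simp: g(2) siegel_incl_def\<close>)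
  have gv: "g *\<^sub>v (?i *\<^sub>v x) = ?i *\<^sub>v (A *\<^sub>v x)" if "x \<in> carrier_vec l" for x
    using assoc_mult_mat_vec[OF gc siegel_incl_carrier that] assoc_mult_mat_vec[OF siegel_incl_carrier c(4) that]
    by (simp add: gi)
  have "(\<lambda>v. g *\<^sub>v v) ` siegel_space F l = siegel_space F l"
    unfolding siegel_space_eq m[symmetric]
  proof
    show "(\<lambda>v. g *\<^sub>v v) ` (\<lambda>x. ?i *\<^sub>v x) ` carrier_vec l \<subseteq> (\<lambda>x. ?i *\<^sub>v x) ` carrier_vec l"
    proof clarify
      fix x :: "'k vec" assume x: "x \<in> carrier_vec l"
      from mult_mat_vec_carrier[OF c(4) x] show "g *\<^sub>v (?i *\<^sub>v x) \<in> (\<lambda>x. ?i *\<^sub>v x) ` carrier_vec l"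
        unfolding gv[OF x] by (rule imageI)
    qed
    show "(\<lambda>x. ?i *\<^sub>v x) ` carrier_vec l \<subseteq> (\<lambda>v. g *\<^sub>v v) ` (\<lambda>x. ?i *\<^sub>v x) ` carrier_vec l"
    proof clarify
      fix x :: "'k vec" assume x: "x \<in> carrier_vec l"
      have "g *\<^sub>v (?i *\<^sub>v (transpose_mat D *\<^sub>v x)) = ?i *\<^sub>v (A *\<^sub>v (transpose_mat D *\<^sub>v x))"
        by (rule gv) (use x c in auto)
      also have "A *\<^sub>v (transpose_mat D *\<^sub>v x) = (A * transpose_mat D) *\<^sub>v x"
        using c x by (simp add: assoc_mult_mat_vec[of A l l "transpose_mat D" l])
      finally have "?i *\<^sub>v x = g *\<^sub>v (?i *\<^sub>v (transpose_mat D *\<^sub>v x))"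
        using AD' x by simp
      then show "?i *\<^sub>v x \<in> (\<lambda>v. g *\<^sub>v v) ` (\<lambda>x. ?i *\<^sub>v x) ` carrier_vec l"
        using mult_mat_vec_carrier[of "transpose_mat D" l l x] x c by (simp add: image_image image_eqI)
    qed
  qed
  then show ?thesis using g(1) by (simp add: siegel_parabolic_def)
qed

section \<open>Group structure of the parabolic and its double cosets\<close>

lemma siegel_parabolic_isometry: "g \<in> siegel_parabolic F l \<Longrightarrow> g \<in> isometry_group F l"
  by (simp add: siegel_parabolic_def)

lemma siegel_space_carrier: "v \<in> siegel_space F l \<Longrightarrow> v \<in> carrier_vec (dimn F l)"
  using mult_mat_vec_carrier[OF siegel_incl_carrier] by (auto simp: siegel_space_eq dimn_eq)

lemma siegel_parabolic_mult:
  fixes g :: "'k::field mat"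
  assumes two: "(2 :: 'k) \<noteq> 0" and g: "g \<in> siegel_parabolic F l" and h: "h \<in> siegel_parabolic F l"
  shows "g * h \<in> siegel_parabolic F l"
proof -
  note gc = isometry_group_carrier[OF siegel_parabolic_isometry[OF g]]
    and hc = isometry_group_carrier[OF siegel_parabolic_isometry[OF h]]
  have "(\<lambda>v. (g * h) *\<^sub>v v) ` siegel_space F l = (\<lambda>v. g *\<^sub>v (h *\<^sub>v v)) ` siegel_space F l"
    by (rule image_cong[OF refl]) (rule assoc_mult_mat_vec[OF gc hc siegel_space_carrier])
  also have "\<dots> = (\<lambda>v. g *\<^sub>v v) ` (\<lambda>v. h *\<^sub>v v) ` siegel_space F l" by (simp add: image_image)
  also have "\<dots> = siegel_space F l" using g h by (simp add: siegel_parabolic_def)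
  finally show ?thesis
    using isometry_group_mult[OF two] g h by (simp add: siegel_parabolic_def)
qed

lemma siegel_parabolic_inverse:
  fixes g :: "'k::field mat"
  assumes two: "(2 :: 'k) \<noteq> 0" and g: "g \<in> siegel_parabolic F l"
  obtains h where "h \<in> siegel_parabolic F l" "g * h = 1\<^sub>m (dimn F l)" "h * g = 1\<^sub>m (dimn F l)"
proof -
  from isometry_group_inverse[OF two siegel_parabolic_isometry[OF g]] obtain h where
    h: "h \<in> isometry_group F l" "g * h = 1\<^sub>m (dimn F l)" "h * g = 1\<^sub>m (dimn F l)" .
  note gc = isometry_group_carrier[OF siegel_parabolic_isometry[OF g]]
    and hc = isometry_group_carrier[OF h(1)]
  have "(\<lambda>v. h *\<^sub>v v) ` siegel_space F l = (\<lambda>v. h *\<^sub>v v) ` (\<lambda>v. g *\<^sub>v v) ` siegel_space F l"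
    using g by (simp add: siegel_parabolic_def)
  also have "\<dots> = (\<lambda>v. v) ` siegel_space F l" unfolding image_image
  proof (rule image_cong)
    fix v :: "'k vec" assume "v \<in> siegel_space F l"
    from siegel_space_carrier[OF this] show "h *\<^sub>v (g *\<^sub>v v) = v"
      using assoc_mult_mat_vec[OF hc gc, of v] h(3) by simp
  qed simp
  finally have "h \<in> siegel_parabolic F l" using h(1) by (simp add: siegel_parabolic_def)
  then show ?thesis using h(2,3) by (rule that)
qed

text \<open>Allows g to be normalized by parabolic elements on both sides before its double coset is
  identified.\<close>

lemma double_coset_absorb:
  fixes g :: "'k::field mat"
  assumes two: "(2 :: 'k) \<noteq> 0" and p: "p \<in> siegel_parabolic F l" and q: "q \<in> siegel_parabolic F l"
    and g: "g \<in> carrier_mat (dimn F l) (dimn F l)" and x: "x \<in> carrier_mat (dimn F l) (dimn F l)"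
    and pgq: "p * g * q \<in> double_coset (siegel_parabolic F l) x"
  shows "g \<in> double_coset (siegel_parabolic F l) x"
proof -
  let ?n = "dimn F l"
  from siegel_parabolic_inverse[OF two p] obtain p' where
    p': "p' \<in> siegel_parabolic F l" "p * p' = 1\<^sub>m ?n" "p' * p = 1\<^sub>m ?n" .
  from siegel_parabolic_inverse[OF two q] obtain q' where
    q': "q' \<in> siegel_parabolic F l" "q * q' = 1\<^sub>m ?n" "q' * q = 1\<^sub>m ?n" .
  from pgq obtain r s where r: "r \<in> siegel_parabolic F l" and s: "s \<in> siegel_parabolic F l"
    and eq: "p * g * q = r * x * s" unfolding double_coset_def by auto
  note c = isometry_group_carrier[OF siegel_parabolic_isometry[OF p]] isometry_group_carrier[OF siegel_parabolic_isometry[OF q]]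
     isometry_group_carrier[OF siegel_parabolic_isometry[OF p'(1)]] isometry_group_carrier[OF siegel_parabolic_isometry[OF q'(1)]]
     isometry_group_carrier[OF siegel_parabolic_isometry[OF r]] isometry_group_carrier[OF siegel_parabolic_isometry[OF s]] g x
  have "g = (p' * p) * g * (q * q')" unfolding p'(3) q'(2) using g by simp
  also have "\<dots> = p' * (p * g * q) * q'"
    using c by (simp add: square_mat_assoc[of _ ?n] square_mat_mult[of _ ?n])
  also have "\<dots> = (p' * r) * x * (s * q')"
    using c unfolding eq by (simp add: square_mat_assoc[of _ ?n] square_mat_mult[of _ ?n])
  finally show ?thesis
    unfolding double_coset_def
    using siegel_parabolic_mult[OF two p'(1) r] siegel_parabolic_mult[OF two s q'(1)] by (intro CollectI exI conjI)
qed

section \<open>Double cosets of the parabolic\<close>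

text \<open>\<open>omega_upper\<close> and \<open>omega_lower\<close> are the coefficients of the
  matrix units at (i, -i) and (-i, i) in w_i.\<close>

definition omega_upper :: "family \<Rightarrow> 'k::field" where
  "omega_upper F = (if F = Odd_Orthogonal then - 1 else 1)"

definition omega_lower :: "family \<Rightarrow> 'k::field" where
  "omega_lower F = (if F = Even_Orthogonal then 1 else - 1)"

lemma omega_coeffs [simp]:
  "omega_upper F * omega_upper F = 1" "omega_lower F * omega_lower F = 1"
  "form_sign F * (omega_lower F * omega_upper F) = 1"
  by (cases F; simp add: omega_upper_def omega_lower_def form_sign_def)+

definition idem :: "nat \<Rightarrow> nat \<Rightarrow> 'k::field mat" where
  "idem l r = mat_diag l (\<lambda>i. if i < r then 1 else 0)"

lemma idem_carrier [simp]: "idem l r \<in> carrier_mat l l"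
  by (simp add: idem_def)

text \<open>The common shape of \<omega>_r and its inverse: the first r coordinate pairs (i, -i) are
  exchanged with coefficients s and t, and e_0, if present, is scaled by c. With s and t as
  parameters, inversion is the exchange of s and t, provided c, s and t square to 1.\<close>

definition flip :: "nat \<Rightarrow> nat \<Rightarrow> nat \<Rightarrow> 'k::field \<Rightarrow> 'k \<Rightarrow> 'k \<Rightarrow> 'k mat" where
  "flip m l r c s t = blk m l (mat_diag m (\<lambda>_. c)) (0\<^sub>m m l) (0\<^sub>m m l)
     (0\<^sub>m l m) (mat_diag l (\<lambda>i. if i < r then 0 else 1)) (mat_diag l (\<lambda>i. if i < r then s else 0))
     (0\<^sub>m l m) (mat_diag l (\<lambda>i. if i < r then t else 0)) (mat_diag l (\<lambda>i. if i < r then 0 else 1))"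

section \<open>The elements w_i and \<omega>_r in block form\<close>

lemma blk_eqI:
  "a = a' \<Longrightarrow> y = y' \<Longrightarrow> z = z' \<Longrightarrow> E = E' \<Longrightarrow> A = A' \<Longrightarrow> B = B' \<Longrightarrow> H = H' \<Longrightarrow> C = C' \<Longrightarrow> D = D' \<Longrightarrow>
   blk m l a y z E A B H C D = blk m l a' y' z' E' A' B' H' C' D'"
  by simp

lemma one_eq_blk:
  "1\<^sub>m (m + 2 * l) = blk m l (1\<^sub>m m) (0\<^sub>m m l) (0\<^sub>m m l) (0\<^sub>m l m) (1\<^sub>m l) (0\<^sub>m l l) (0\<^sub>m l m) (0\<^sub>m l l) (1\<^sub>m l)"
  by (rule eq_matI) (auto simp: blk_def)

lemma mat_diag_index: "i < n \<Longrightarrow> j < n \<Longrightarrow> mat_diag n f $$ (i, j) = (if i = j then f j else 0)"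
  by (simp add: mat_diag_def)

lemma mat_diag_mult_index:
  "A \<in> carrier_mat n k \<Longrightarrow> i < n \<Longrightarrow> j < k \<Longrightarrow> (mat_diag n f * A) $$ (i, j) = f i * A $$ (i, j)"
  "B \<in> carrier_mat k n \<Longrightarrow> i < k \<Longrightarrow> j < n \<Longrightarrow> (B * mat_diag n f) $$ (i, j) = B $$ (i, j) * f j"
  by (simp_all add: mat_diag_mult_left mat_diag_mult_right)

lemma mat_diag_carrier [simp]: "mat_diag n f \<in> carrier_mat n n"
  by (simp add: mat_diag_def)

lemma mat_diag_dims [simp]: "dim_row (mat_diag n f) = n" "dim_col (mat_diag n f) = n"
  by (simp_all add: mat_diag_def)

lemma transpose_mat_diag: "transpose_mat (mat_diag n f) = mat_diag n f"
  by (rule eq_matI) (auto simp: mat_diag_def)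

lemma w_elt_eq_blk:
  assumes "r < l"
  shows "(w_elt F l (int (Suc r)) :: 'k::field mat) = blk (mid F) l (mat_diag (mid F) (\<lambda>_. - 1)) (0\<^sub>m (mid F) l) (0\<^sub>m (mid F) l)
     (0\<^sub>m l (mid F)) (mat_diag l (\<lambda>i. if i = r then 0 else 1)) (mat_diag l (\<lambda>i. if i = r then omega_upper F else 0))
     (0\<^sub>m l (mid F)) (mat_diag l (\<lambda>i. if i = r then omega_lower F else 0)) (mat_diag l (\<lambda>i. if i = r then 0 else 1))"
proof -
  let ?m = "mid F" and ?w = "w_elt F l (int (Suc r)) :: 'k mat"
  let ?R = "blk ?m l (mat_diag ?m (\<lambda>_. - 1)) (0\<^sub>m ?m l) (0\<^sub>m ?m l)
     (0\<^sub>m l ?m) (mat_diag l (\<lambda>i. if i = r then 0 else 1)) (mat_diag l (\<lambda>i. if i = r then omega_upper F else 0))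
     (0\<^sub>m l ?m) (mat_diag l (\<lambda>i. if i = r then omega_lower F else 0)) (mat_diag l (\<lambda>i. if i = r then 0 else 1)) :: 'k mat"
  \<comment> \<open>Labels start at 1 and positions at 0, so the label r + 1 sits in place r of its
    block.\<close>
  have p: "pos F l (int (Suc r)) = ?m + r" "pos F l (- int (Suc r)) = ?m + l + r"
    by (simp_all add: pos_def mid_def)
  have p0: "pos F' l 0 = 0" for F' by (simp add: pos_def)
  have c: "?w \<in> carrier_mat (?m + 2 * l) (?m + 2 * l)"
    by (rule carrier_matI; cases F; simp add: Let_def matrix_unit_def mid_def)
  let ?d = "\<lambda>b :: bool. if b then 1 else 0 :: 'k"
  \<comment> \<open>One entry formula covers all families: the term with factor 2 is the matrix unit
    at (0, 0) in the odd case and vanishes when \<open>?m = 0\<close>.\<close>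
  have w: "?w $$ (i, j) = ?d (i = j) - 2 * ?d (i < ?m \<and> j < ?m) - ?d (i = ?m + r \<and> j = ?m + r)
      - ?d (i = ?m + l + r \<and> j = ?m + l + r) + omega_upper F * ?d (i = ?m + r \<and> j = ?m + l + r)
      + omega_lower F * ?d (i = ?m + l + r \<and> j = ?m + r)"
    if ij: "i < ?m + 2 * l" "j < ?m + 2 * l" for i j
    using ij unfolding p[symmetric]
    by (cases F) (simp_all add: Let_def matrix_unit_def p0 mid_def omega_upper_def omega_lower_def del: of_nat_Suc)
  have "?w $$ (i, j) = ?R $$ (i, j)" if ij: "i < ?m + 2 * l" "j < ?m + 2 * l" for i j
  proof -
    have m1: "?m \<le> 1" by (simp add: mid_def)
    have split: "k < ?m \<or> (\<exists>k'. k' < l \<and> k = ?m + k') \<or> (\<exists>k'. k' < l \<and> k = ?m + l + k')" if k: "k < ?m + 2 * l" for k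
    proof -
      consider "k < ?m" | "?m \<le> k" "k - ?m < l" | "?m + l \<le> k" "k - ?m - l < l"
        using k by arith
      then show ?thesis
      proof cases
        case 2
        then show ?thesis by (intro disjI2 disjI1 exI[of _ "k - ?m"]) simp
      next
        case 3
        then show ?thesis by (intro disjI2 exI[of _ "k - ?m - l"]) simp
      qed simp
    qed
    show ?thesis
      using split[OF ij(1)] split[OF ij(2)] m1 assms unfolding w[OF ij]
      by (elim disjE exE conjE) (simp_all add: blk_def mat_diag_index)
  qed
  then show ?thesis using c by (intro eq_matI) auto
qed

text \<open>The factors w_i act on disjoint pairs (i, -i), so their exchanges do not interact; only
  the sign on e_0 accumulates, to (-1)^r.\<close>

lemma omega_eq_flip:
  assumes "r \<le> l"
  shows "(omega F l r :: 'k::field mat) = flip (mid F) l r ((- 1) ^ r) (omega_upper F) (omega_lower F)"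
  using assms
proof (induction r)
  case 0
  show ?case
    by (rule eq_matI) (auto simp: dimn_eq flip_def blk_def mat_diag_def)
next
  case (Suc r)
  then have "(omega F l (Suc r) :: 'k mat) = flip (mid F) l r ((- 1) ^ r) (omega_upper F) (omega_lower F) * w_elt F l (int (Suc r))"
    by (simp del: of_nat_Suc)
  also have "\<dots> = flip (mid F) l (Suc r) ((- 1) ^ Suc r) (omega_upper F) (omega_lower F)"
    using Suc.prems unfolding w_elt_eq_blk[OF Suc_le_lessD[OF Suc.prems]] flip_def
    by (subst blk_mult; (simp; fail)?)
      (rule blk_eqI; rule eq_matI; simp add: mat_diag_index less_Suc_eq)
  finally show ?case .
qed

lemma flip_carrier [simp]: "flip m l r c s t \<in> carrier_mat (m + 2 * l) (m + 2 * l)"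
  by (simp add: flip_def)

lemma omega_carrier: "r \<le> l \<Longrightarrow> omega F l r \<in> carrier_mat (dimn F l) (dimn F l)"
  by (simp add: omega_eq_flip dimn_eq)

lemma flip_inverse:
  assumes "c * c = 1" "s * s = 1" "t * t = (1 :: 'k::field)"
  shows "flip m l r c s t * flip m l r c t s = 1\<^sub>m (m + 2 * l)"
  unfolding flip_def one_eq_blk
  by (subst blk_mult; (simp; fail)?)
    (rule blk_eqI; rule eq_matI; use assms in \<open>simp add: mat_diag_index\<close>)

lemma flip_isometry:
  assumes two: "(2 :: 'k::field) \<noteq> 0" and "c * c = 1" "form_sign F * (t * s) = (1 :: 'k)"
  shows "flip (mid F) l r c s t \<in> isometry_group F l"
proof (rule isometry_groupI[OF two])
  show "flip (mid F) l r c s t \<in> carrier_mat (dimn F l) (dimn F l)" by (simp add: dimn_eq)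
  \<comment> \<open>As \<epsilon> squares to 1, the hypothesis is the same as s t = \<epsilon>, the
    form in which the lower left block of the relation needs it.\<close>
  have "s * t = form_sign F * form_sign F * (t * s)" by simp
  also have "\<dots> = form_sign F" using assms(3) by (simp only: mult.assoc mult_1_right)
  finally have st: "s * t = form_sign F" .
  show "transpose_mat (flip (mid F) l r c s t) * form F l * flip (mid F) l r c s t = form F l"
    unfolding flip_def
    by (subst blk_congruence_form; (simp; fail)?)
      (unfold form_eq_blk, rule blk_eqI; rule eq_matI; use assms st in \<open>simp add: transpose_mat_diag mat_diag_index algebra_simps\<close>)
qed

section \<open>Reduction to \<omega>_r when the lower left block is diag(I_r, 0)\<close>

lemma idem_dims [simp]: "dim_row (idem l r) = l" "dim_col (idem l r) = l"
  by (simp_all add: idem_def)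

lemma zero_mat_add:
  "dim_row X = n \<Longrightarrow> dim_col X = k \<Longrightarrow> 0\<^sub>m n k + X = (X :: 'a::comm_ring_1 mat)"
  "dim_row X = n \<Longrightarrow> dim_col X = k \<Longrightarrow> X + 0\<^sub>m n k = X"
  by (rule eq_matI; auto)+

lemma double_coset_normal_form:
  fixes a :: "'k::field mat"
  assumes two: "(2 :: 'k) \<noteq> 0" and m: "m = mid F" and rl: "r \<le> l"
    and g: "blk m l a y z E A B H (idem l r) D \<in> isometry_group F l"
    and c: "a \<in> carrier_mat m m" "y \<in> carrier_mat m l" "z \<in> carrier_mat m l"
    "E \<in> carrier_mat l m" "A \<in> carrier_mat l l" "B \<in> carrier_mat l l"
    "H \<in> carrier_mat l m" "D \<in> carrier_mat l l"
  shows "blk m l a y z E A B H (idem l r) D \<in> double_coset (siegel_parabolic F l) (omega F l r)"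
proof -
  let ?g = "blk m l a y z E A B H (idem l r) D"
  let ?\<epsilon> = "form_sign F :: 'k"
  define q where "q i j = (transpose_mat y * y) $$ (i, j)" for i j
  have q: "q i j = (\<Sum>k<m. y $$ (k, i) * y $$ (k, j))" if "i < l" "j < l" for i j
    using that c by (simp add: q_def scalar_prod_def atLeast0LessThan)
  have q_sym: "q i j = q j i" if "i < l" "j < l" for i j
    using that by (simp add: q mult.commute)
  \<comment> \<open>Either \<epsilon> = 1, or the family is symplectic and q is an empty
    sum.\<close>
  have q_eps: "?\<epsilon> * q i j = q i j" if "i < l" "j < l" for i j
    using that by (cases F) (simp_all add: q m mid_def form_sign_def)
  have rel: "2 * q i j + (if j < r then A $$ (j, i) else 0) + ?\<epsilon> * (if i < r then A $$ (i, j) else 0) = 0"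
    if ij: "i < l" "j < l" for i j
  proof -
    have "2 \<cdot>\<^sub>m (transpose_mat y * y) + transpose_mat A * idem l r + ?\<epsilon> \<cdot>\<^sub>m (transpose_mat (idem l r) * A) = 0\<^sub>m l l"
      by (rule isometry_group_blocks(1)[OF g m]) (use c in auto)
    from arg_cong[OF this, of "\<lambda>X. X $$ (i, j)"] show ?thesis
      using ij c mat_diag_mult_index(1)[of A l l i j "\<lambda>i. if i < r then 1 else 0"]
        mat_diag_mult_index(2)[of "transpose_mat A" l l i j "\<lambda>i. if i < r then 1 else 0"]
      by (simp add: idem_def transpose_mat_diag q_def split: if_splits)
  qed
  \<comment> \<open>On the diagonal beyond r both terms in A drop out of \<open>rel\<close>, leaving
    2 y_j^2 = 0. This needs y to have a single row, since a sum of several squares could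
    vanish.\<close>
  have y0: "y $$ (k, j) = 0" if k: "k < m" and j: "r \<le> j" "j < l" for k j
  proof -
    have "m = 1" using k m by (auto simp: mid_def split: if_splits)
    then show ?thesis using rel[OF j(2) j(2)] j q[of j j] k two by (simp add: lessThan_Suc)
  qed
  have q0: "q i j = 0" if "i < l" "j < l" "r \<le> i \<or> r \<le> j" for i j
    unfolding q[OF that(1,2)] by (rule sum.neutral) (use y0 that in auto)
  have A0: "A $$ (i, j) = 0" if "i < r" "r \<le> j" "j < l" for i j
    using rel[of i j] q0[of i j] that rl by (auto simp: form_sign_def split: if_splits)
  \<comment> \<open>Chosen so that in \<open>u * g\<close> the middle block of the columns \<open>1, \<dots>, l\<close> vanishes in its first \<open>r\<close> rows.\<close>
  define S where "S = mat l l (\<lambda>(i, j). (if j < r then - (A $$ (i, j) + q i j)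
    else if i < r then ?\<epsilon> * (A $$ (j, i) + q j i) else 0) - q i j)"
  have S: "S \<in> carrier_mat l l" by (simp add: S_def)
  \<comment> \<open>The lower right block of the condition that u is an isometry. On the first r
    indices it follows from \<open>rel\<close>. For one index below r and the other not, the second
    branch of \<open>S\<close> was chosen to be the value forced by the first. In the remaining
    corner all terms vanish.\<close>
  have skew: "2 * q i j + S $$ (j, i) + ?\<epsilon> * S $$ (i, j) = 0" if ij: "i < l" "j < l" for i j
  proof -
    have e: "?\<epsilon> * (?\<epsilon> * x) = x" for x by (simp add: mult.assoc[symmetric])
    show ?thesis
      using rel[OF ij] rel[OF ij(2,1)] ij q_sym[OF ij] q_eps[OF ij] q_eps[OF ij(2,1)]
      by (auto simp: S_def e algebra_simps split: if_splits)
  qed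
  \<comment> \<open>The block \<open>- y\<close> makes the leading row of \<open>u * ?g\<close>
    equal to y - y diag(I_r, 0), which is 0 by \<open>y0\<close>; preserving the form then forces
    the block 2 y^T.\<close>
  define u where "u = blk m l (1\<^sub>m m) (0\<^sub>m m l) (- y) (2 \<cdot>\<^sub>m transpose_mat y) (1\<^sub>m l) S (0\<^sub>m l m) (0\<^sub>m l l) (1\<^sub>m l)"
  have yE: "?\<epsilon> * (2 * y $$ (i, j)) = 2 * y $$ (i, j)" if "i < m" for i j
    using that by (cases F) (auto simp: m mid_def form_sign_def)
  have "u \<in> isometry_group F l"
  proof (rule isometry_groupI[OF two])
    show "u \<in> carrier_mat (dimn F l) (dimn F l)" by (simp add: u_def dimn_eq m)
    have yy: "transpose_mat (- y) * (- y) = transpose_mat y * y"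
      by (rule eq_matI) (use c in \<open>auto simp: scalar_prod_def sum_negf\<close>)
    have "transpose_mat u * form F l * u = blk m l (2 \<cdot>\<^sub>m 1\<^sub>m m) (0\<^sub>m m l) (0\<^sub>m m l)
       (0\<^sub>m l m) (0\<^sub>m l l) (1\<^sub>m l) (0\<^sub>m l m) (?\<epsilon> \<cdot>\<^sub>m 1\<^sub>m l) (0\<^sub>m l l)"
      unfolding u_def
      apply (subst blk_congruence_form[OF m]; (use c S in \<open>simp; fail\<close>)?)
      apply (rule blk_eqI; rule eq_matI; use c S yE in \<open>simp add: yy\<close>)
      using skew q_def by auto
    then show "transpose_mat u * form F l * u = form F l" by (simp add: form_eq_blk m)
  qed
  then have uP: "u \<in> siegel_parabolic F l"
    by (rule siegel_parabolicI[OF _ u_def m]) (use c S in auto)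
  let ?w = "omega F l r :: 'k mat"
  define w' where "w' = flip m l r ((- 1) ^ r) (omega_lower F) (omega_upper F :: 'k)"
  have sq: "(- 1) ^ r * (- 1) ^ r = (1 :: 'k)" by (simp add: power_mult_distrib[symmetric])
  have ww': "?w * w' = 1\<^sub>m (dimn F l)"
    unfolding omega_eq_flip[OF rl] w'_def m dimn_eq by (rule flip_inverse) (simp_all add: sq)
  have w': "w' \<in> isometry_group F l"
    unfolding w'_def m
    by (rule flip_isometry[OF two sq]) (metis omega_coeffs(3) mult.commute)
  let ?h = "w' * (u * ?g)"
  have "?h \<in> isometry_group F l"
    using isometry_group_mult[OF two w' isometry_group_mult[OF two \<open>u \<in> isometry_group F l\<close> g]] .
  moreover have "u * ?g = blk m l (1\<^sub>m m * a + 0\<^sub>m m l * E + - y * H) (y + - y * idem l r) (1\<^sub>m m * z + 0\<^sub>m m l * B + - y * D)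
     (2 \<cdot>\<^sub>m transpose_mat y * a + 1\<^sub>m l * E + S * H) (2 \<cdot>\<^sub>m transpose_mat y * y + A + S * idem l r)
     (2 \<cdot>\<^sub>m transpose_mat y * z + 1\<^sub>m l * B + S * D)
     (0\<^sub>m l m * a + 0\<^sub>m l l * E + 1\<^sub>m l * H) (idem l r) (0\<^sub>m l m * z + 0\<^sub>m l l * B + 1\<^sub>m l * D)"
    unfolding u_def
    by (subst blk_mult; (use c S in \<open>simp add: left_mult_one_mat[OF idem_carrier]; fail\<close>))
  moreover have y1: "y + - y * idem l r = 0\<^sub>m m l"
  proof (rule eq_matI)
    fix i j assume "i < dim_row (0\<^sub>m m l)" "j < dim_col (0\<^sub>m m l)"
    then have ij: "i < m" "j < l" by simp_all
    have "(- y * idem l r) $$ (i, j) = (- y) $$ (i, j) * (if j < r then 1 else 0)"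
      unfolding idem_def using ij c by (intro mat_diag_mult_index(2)) auto
    then show "(y + - y * idem l r) $$ (i, j) = 0\<^sub>m m l $$ (i, j)"
      using ij c y0[of i j] by (simp del: index_mult_mat(1))
  qed (use c in auto)
  moreover obtain A1 where A1: "A1 = 2 \<cdot>\<^sub>m transpose_mat y * y + A + S * idem l r" by blast
  ultimately have h: "?h \<in> isometry_group F l" "u * ?g = blk m l (1\<^sub>m m * a + 0\<^sub>m m l * E + - y * H) (0\<^sub>m m l) (1\<^sub>m m * z + 0\<^sub>m m l * B + - y * D)
     (2 \<cdot>\<^sub>m transpose_mat y * a + 1\<^sub>m l * E + S * H) A1 (2 \<cdot>\<^sub>m transpose_mat y * z + 1\<^sub>m l * B + S * D)
     (0\<^sub>m l m * a + 0\<^sub>m l l * E + 1\<^sub>m l * H) (idem l r) (0\<^sub>m l m * z + 0\<^sub>m l l * B + 1\<^sub>m l * D)"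
    by simp_all
  have A1c: "A1 \<in> carrier_mat l l" using c S by (simp add: A1)
  have A1_0: "A1 $$ (i, j) = 0" if "i < r" "j < l" for i j
  proof -
    have "i < l" using that rl by simp
    have "(2 \<cdot>\<^sub>m transpose_mat y * y) $$ (i, j) = 2 * q i j"
      using c \<open>i < l\<close> that(2) by (subst mult_smult_assoc_mat[of _ l m _ l]) (auto simp: q_def)
    then have "A1 $$ (i, j) = 2 * q i j + A $$ (i, j) + S $$ (i, j) * (if j < r then 1 else 0)"
      using that \<open>i < l\<close> c S mat_diag_mult_index(2)[OF S \<open>i < l\<close> that(2), of "\<lambda>i. if i < r then 1 else 0"]
      by (simp add: A1 idem_def del: index_mult_mat(1))
    then show ?thesis
      using A0[of i j] q0[of i j] that \<open>i < l\<close> by (auto simp: S_def)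
  qed
  have "?h \<in> siegel_parabolic F l"
  proof (rule siegel_parabolicI[OF h(1) _ m])
    let ?d = "\<lambda>f. mat_diag l f :: 'k mat"
    \<comment> \<open>This is the lower left block of \<open>?h\<close>: \<open>w'\<close> moves the
      first r rows of \<open>A1\<close>, all zero, into its first r rows, and keeps below them the
      rows of \<open>idem l r\<close> from r on, which are zero as well.\<close>
    have z1: "?d (\<lambda>i. if i < r then omega_upper F else 0) * A1 + ?d (\<lambda>i. if i < r then 0 else 1) * idem l r = 0\<^sub>m l l"
      by (rule eq_matI) (use A1_0 A1c in \<open>auto simp: mat_diag_mult_index(1)[of _ l l] idem_def mat_diag_index simp del: index_mult_mat(1)\<close>)
    show "?h = blk m l (mat_diag m (\<lambda>_. (- 1) ^ r) * (1\<^sub>m m * a + 0\<^sub>m m l * E + - y * H)) (0\<^sub>m m l) (mat_diag m (\<lambda>_. (- 1) ^ r) * (1\<^sub>m m * z + 0\<^sub>m m l * B + - y * D))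
       (?d (\<lambda>i. if i < r then 0 else 1) * (2 \<cdot>\<^sub>m transpose_mat y * a + 1\<^sub>m l * E + S * H) + ?d (\<lambda>i. if i < r then omega_lower F else 0) * (0\<^sub>m l m * a + 0\<^sub>m l l * E + 1\<^sub>m l * H))
       (?d (\<lambda>i. if i < r then 0 else 1) * A1 + ?d (\<lambda>i. if i < r then omega_lower F else 0) * idem l r)
       (?d (\<lambda>i. if i < r then 0 else 1) * (2 \<cdot>\<^sub>m transpose_mat y * z + 1\<^sub>m l * B + S * D) + ?d (\<lambda>i. if i < r then omega_lower F else 0) * (0\<^sub>m l m * z + 0\<^sub>m l l * B + 1\<^sub>m l * D))
       (?d (\<lambda>i. if i < r then omega_upper F else 0) * (2 \<cdot>\<^sub>m transpose_mat y * a + 1\<^sub>m l * E + S * H) + ?d (\<lambda>i. if i < r then 0 else 1) * (0\<^sub>m l m * a + 0\<^sub>m l l * E + 1\<^sub>m l * H))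
       (0\<^sub>m l l)
       (?d (\<lambda>i. if i < r then omega_upper F else 0) * (2 \<cdot>\<^sub>m transpose_mat y * z + 1\<^sub>m l * B + S * D) + ?d (\<lambda>i. if i < r then 0 else 1) * (0\<^sub>m l m * z + 0\<^sub>m l l * B + 1\<^sub>m l * D))"
      unfolding h(2) w'_def flip_def
      by (subst blk_mult; (use c S A1c in \<open>simp; fail\<close>)?) (rule blk_eqI; use c S A1c z1 in \<open>simp add: zero_mat_add\<close>)
  qed (use c S A1c in auto)
  moreover have "u * ?g = ?w * ?h"
  proof -
    have cc: "?w \<in> carrier_mat (dimn F l) (dimn F l)" "w' \<in> carrier_mat (dimn F l) (dimn F l)" "u * ?g \<in> carrier_mat (dimn F l) (dimn F l)"
      using omega_carrier[OF rl] isometry_group_carrier[OF w'] by (auto simp: u_def dimn_eq m)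
    show ?thesis using square_mat_assoc[OF cc] by (simp only: ww' left_mult_one_mat[OF cc(3)])
  qed
  moreover have one: "(1\<^sub>m (dimn F l) :: 'k mat) \<in> siegel_parabolic F l"
  proof -
    have "(1\<^sub>m (dimn F l) :: 'k mat) \<in> isometry_group F l"
      by (rule isometry_groupI[OF two]) (simp_all add: left_mult_one_mat[OF form_carrier] right_mult_one_mat[OF form_carrier])
    then show ?thesis
      by (rule siegel_parabolicI[OF _ _ m]) ((simp_all add: dimn_eq m one_eq_blk)+)
  qed
  moreover have "u * ?g * 1\<^sub>m (dimn F l) = u * ?g"
    unfolding u_def dimn_eq m by (rule right_mult_one_mat[OF square_mat_mult[OF blk_carrier blk_carrier]])
  moreover have "1\<^sub>m (dimn F l) * ?w = ?w"
    by (rule left_mult_one_mat[OF omega_carrier[OF rl]])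
  ultimately have "u * ?g * 1\<^sub>m (dimn F l) = 1\<^sub>m (dimn F l) * ?w * ?h" "?h \<in> siegel_parabolic F l"
    by simp_all
  then have "u * ?g * 1\<^sub>m (dimn F l) \<in> double_coset (siegel_parabolic F l) ?w"
    unfolding double_coset_def using one by blast
  then show ?thesis
    by (rule double_coset_absorb[OF two uP one isometry_group_carrier[OF g] omega_carrier[OF rl]])
qed

text \<open>A Levi element acts by A on the Siegel space and by the inverse transpose D on the span
  of e_{-1}, ..., e_{-l}. A left factor therefore multiplies C by its D, a right factor by its
  A.\<close>

lemma levi_siegel_parabolic:
  fixes A :: "'k::field mat"
  assumes two: "(2 :: 'k) \<noteq> 0" and m: "m = mid F" and c: "A \<in> carrier_mat l l" "D \<in> carrier_mat l l"
    and AD: "transpose_mat A * D = 1\<^sub>m l"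
  shows "blk m l (1\<^sub>m m) (0\<^sub>m m l) (0\<^sub>m m l) (0\<^sub>m l m) A (0\<^sub>m l l) (0\<^sub>m l m) (0\<^sub>m l l) D \<in> siegel_parabolic F l"
proof -
  let ?g = "blk m l (1\<^sub>m m) (0\<^sub>m m l) (0\<^sub>m m l) (0\<^sub>m l m) A (0\<^sub>m l l) (0\<^sub>m l m) (0\<^sub>m l l) D"
  have "transpose_mat (transpose_mat A * D) = 1\<^sub>m l" by (simp add: AD)
  then have DA: "transpose_mat D * A = 1\<^sub>m l" using c by (simp add: transpose_mult[of _ l l])
  have "?g \<in> isometry_group F l"
  proof (rule isometry_groupI[OF two])
    show "transpose_mat ?g * form F l * ?g = form F l"
      by (subst blk_congruence_form[OF m]; (use c in \<open>simp; fail\<close>)?)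
        (unfold form_eq_blk m[symmetric], rule blk_eqI; rule eq_matI; use c in \<open>simp add: AD DA\<close>)
  qed (simp add: dimn_eq m)
  then show ?thesis
    by (rule siegel_parabolicI[OF _ refl m]) (use c in auto)
qed

lemma double_coset_of_rank_normal_form:
  fixes g :: "'k::field mat"
  assumes two: "(2 :: 'k) \<noteq> 0" and rl: "r \<le> l" and g: "g \<in> isometry_group F l"
    and X: "X \<in> carrier_mat l l" "X' \<in> carrier_mat l l" "X' * X = 1\<^sub>m l"
    and Y: "Y \<in> carrier_mat l l" "Y' \<in> carrier_mat l l" "Y * Y' = 1\<^sub>m l"
    and C: "mat l l (\<lambda>(i, j). g $$ (mid F + l + i, mid F + j)) = X * idem l r * Y"
  shows "g \<in> double_coset (siegel_parabolic F l) (omega F l r)"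
proof -
  define m where "m = mid F"
  obtain a y z E A B H C D where gb: "g = blk m l a y z E A B H C D"
    and c: "a \<in> carrier_mat m m" "y \<in> carrier_mat m l" "z \<in> carrier_mat m l"
    "E \<in> carrier_mat l m" "A \<in> carrier_mat l l" "B \<in> carrier_mat l l"
    "H \<in> carrier_mat l m" "C \<in> carrier_mat l l" "D \<in> carrier_mat l l"
    and C': "C = X * idem l r * Y"
    using blk_cases[of g m l] isometry_group_carrier[OF g] C unfolding dimn_eq m_def by metis
  have XX': "X * X' = 1\<^sub>m l" by (rule mat_mult_left_right_inverse[OF X(2,1,3)])
  have YY': "transpose_mat Y' * transpose_mat Y = 1\<^sub>m l"
    using transpose_mult[OF Y(1,2)] Y(3) by simp
  \<comment> \<open>\<open>?p\<close> is to multiply C by X' from the left, so X' is its lower right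
    block and the inverse transpose X^T its middle one; \<open>?q\<close> is to multiply C by Y'
    from the right. Together they turn C into diag(I_r, 0).\<close>
  let ?p = "blk m l (1\<^sub>m m) (0\<^sub>m m l) (0\<^sub>m m l) (0\<^sub>m l m) (transpose_mat X) (0\<^sub>m l l) (0\<^sub>m l m) (0\<^sub>m l l) X'"
  let ?q = "blk m l (1\<^sub>m m) (0\<^sub>m m l) (0\<^sub>m m l) (0\<^sub>m l m) Y' (0\<^sub>m l l) (0\<^sub>m l m) (0\<^sub>m l l) (transpose_mat Y)"
  have p: "?p \<in> siegel_parabolic F l"
    by (rule levi_siegel_parabolic[OF two m_def]) (use X XX' in auto)
  have q: "?q \<in> siegel_parabolic F l"
    by (rule levi_siegel_parabolic[OF two m_def]) (use Y YY' in auto)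
  have "X' * C * Y' = (X' * X) * idem l r * (Y * Y')"
    using X(1,2) Y(1,2) unfolding C' by (simp add: square_mat_assoc[of _ l] square_mat_mult[of _ l])
  then have XCY: "X' * C * Y' = idem l r" using X(3) Y(3) by (simp add: left_mult_one_mat[OF idem_carrier] right_mult_one_mat[OF idem_carrier])
  have "?p * g * ?q = blk m l a (y * Y') (z * transpose_mat Y) (transpose_mat X * E) (transpose_mat X * A * Y')
      (transpose_mat X * B * transpose_mat Y) (X' * H) (idem l r) (X' * D * transpose_mat Y)"
    unfolding gb
    apply (subst blk_mult; (use c X Y in \<open>simp; fail\<close>)?)
    apply (subst blk_mult; (use c X Y in \<open>simp; fail\<close>)?)
    apply (rule blk_eqI; use c X Y XCY in \<open>simp add: square_mat_mult[of _ l]\<close>)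
    done
  moreover have "?p * g * ?q \<in> isometry_group F l"
    using isometry_group_mult[OF two isometry_group_mult[OF two siegel_parabolic_isometry[OF p] g] siegel_parabolic_isometry[OF q]] .
  ultimately have "?p * g * ?q \<in> double_coset (siegel_parabolic F l) (omega F l r)"
    using double_coset_normal_form[OF two m_def rl, of a "y * Y'"] c X Y by (simp add: square_mat_mult[of _ l])
  then show ?thesis
    by (rule double_coset_absorb[OF two p q isometry_group_carrier[OF g] omega_carrier[OF rl]])
qed

section \<open>Wedderburn rank reduction\<close>

text \<open>If r < s, the equation makes the first s rows of X vanish from column r on. By
  pigeonhole every term of the Leibniz expansion of det X then contains a zero, contradicting
  invertibility. The scalars c and d accommodate the coefficient \<open>omega_lower\<close> in the
  block of \<omega>_r.\<close>

lemma idem_rank_unique: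
  assumes X: "X \<in> carrier_mat l l" "X' \<in> carrier_mat l l" "X * X' = (1\<^sub>m l :: 'k::field mat)"
    and Y: "Y \<in> carrier_mat l l"
    and eq: "mat_diag l (\<lambda>i. if i < s then c else 0) * X = Y * mat_diag l (\<lambda>i. if i < r then d else 0)"
    and c: "c \<noteq> 0" and s: "s \<le> l"
  shows "s \<le> r"
proof (rule ccontr)
  assume "\<not> s \<le> r"
  have zero: "X $$ (i, j) = 0" if "i < s" "r \<le> j" "j < l" for i j
  proof -
    have "c * X $$ (i, j) = (mat_diag l (\<lambda>i. if i < s then c else 0) * X) $$ (i, j)"
      using that s X by (simp add: mat_diag_mult_index(1)[of _ l l] del: index_mult_mat(1))
    also have "\<dots> = 0"
      unfolding eq using that s Y by (simp add: mat_diag_mult_index(2)[of _ l l] del: index_mult_mat(1))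
    finally show ?thesis using c by simp
  qed
  have "det X = 0"
    unfolding det_def'[OF X(1)]
  proof (rule sum.neutral, rule ballI)
    fix p assume "p \<in> {p. p permutes {0..<l}}"
    then have p: "p permutes {0..<l}" by simp
    have "\<exists>i<s. r \<le> p i"
    proof (rule ccontr)
      assume "\<not> (\<exists>i<s. r \<le> p i)"
      then have "p ` {..<s} \<subseteq> {..<r}" by auto
      then have "card (p ` {..<s}) \<le> r" using card_mono[of "{..<r}"] by fastforce
      moreover have "card (p ` {..<s}) = s"
        using permutes_inj[OF p] by (simp add: card_image inj_on_subset[of p UNIV])
      ultimately show False using \<open>\<not> s \<le> r\<close> by simp
    qed
    then obtain i where i: "i < s" "r \<le> p i" by blast
    then have "p i < l" using permutes_in_image[OF p, of i] s by simp
    then have "(\<Prod>i = 0..<l. X $$ (i, p i)) = 0"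
      using i s zero[OF i] by (intro prod_zero) (auto intro!: bexI[of _ i])
    then show "signof p * (\<Prod>i = 0..<l. X $$ (i, p i)) = 0" by simp
  qed
  moreover have "det X * det X' = 1" using det_mult[OF X(1,2)] X(3) by simp
  ultimately show False by simp
qed

definition wedderburn :: "nat \<Rightarrow> nat \<Rightarrow> 'k::field mat \<Rightarrow> 'k mat" where
  "wedderburn i j C = mat (dim_row C) (dim_col C) (\<lambda>(a, b). C $$ (a, b) - C $$ (a, j) * C $$ (i, b) / C $$ (i, j))"

text \<open>The order of the pivots is left open, so the meaning of the pivot count can be settled
  independently of how the program scans the matrix.\<close>

inductive wedderburn_steps :: "nat \<Rightarrow> 'k::field mat \<Rightarrow> nat \<Rightarrow> 'k mat \<Rightarrow> bool" for l C where
  refl: "wedderburn_steps l C 0 C"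
| step: "wedderburn_steps l C r D \<Longrightarrow> i < l \<Longrightarrow> j < l \<Longrightarrow> D $$ (i, j) \<noteq> 0 \<Longrightarrow>
    wedderburn_steps l C (Suc r) (wedderburn i j D)"

text \<open>The inverse is carried along because it later enters the Levi factors
  explicitly.\<close>

definition invertible_pair :: "nat \<Rightarrow> 'k::field mat \<Rightarrow> 'k mat \<Rightarrow> bool" where
  "invertible_pair l X X' \<longleftrightarrow> X \<in> carrier_mat l l \<and> X' \<in> carrier_mat l l \<and> X * X' = 1\<^sub>m l \<and> X' * X = 1\<^sub>m l"

lemma invertible_pairI:
  "X \<in> carrier_mat l l \<Longrightarrow> X' \<in> carrier_mat l l \<Longrightarrow> X * X' = 1\<^sub>m l \<Longrightarrow> invertible_pair l X X'"
  unfolding invertible_pair_def using mat_mult_left_right_inverse by blast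

lemma invertible_pair_mult:
  assumes "invertible_pair l X X'" "invertible_pair l Y Y'"
  shows "invertible_pair l (X * Y) (Y' * X')"
proof (rule invertible_pairI)
  have c: "X \<in> carrier_mat l l" "X' \<in> carrier_mat l l" "Y \<in> carrier_mat l l" "Y' \<in> carrier_mat l l"
    and i: "X * X' = 1\<^sub>m l" "Y * Y' = 1\<^sub>m l"
    using assms by (auto simp: invertible_pair_def)
  show "X * Y \<in> carrier_mat l l" "Y' * X' \<in> carrier_mat l l" using c by auto
  have "X * Y * (Y' * X') = X * (Y * Y') * X'"
    using c by (simp add: square_mat_assoc[of _ l] square_mat_mult[of _ l])
  then show "X * Y * (Y' * X') = 1\<^sub>m l" using c i by simp
qed

definition equivalent :: "nat \<Rightarrow> 'k::field mat \<Rightarrow> 'k mat \<Rightarrow> bool" where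
  "equivalent l A B \<longleftrightarrow> (\<exists>X X' Y Y'. invertible_pair l X X' \<and> invertible_pair l Y Y' \<and> A = X * B * Y)"

lemma equivalent_refl: "A \<in> carrier_mat l l \<Longrightarrow> equivalent l A A"
  unfolding equivalent_def
  by (intro exI[of _ "1\<^sub>m l"]) (simp add: invertible_pair_def)

lemma equivalent_trans:
  assumes "equivalent l A B" "equivalent l B C" "C \<in> carrier_mat l l"
  shows "equivalent l A C"
proof -
  from assms(1) obtain X X' Y Y' where 1: "invertible_pair l X X'" "invertible_pair l Y Y'" "A = X * B * Y"
    unfolding equivalent_def by blast
  from assms(2) obtain Z Z' W W' where 2: "invertible_pair l Z Z'" "invertible_pair l W W'" "B = Z * C * W"
    unfolding equivalent_def by blast
  have "A = (X * Z) * C * (W * Y)"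
    using 1(1,2) 2(1,2) assms(3) unfolding 1(3) 2(3)
    by (simp add: invertible_pair_def square_mat_assoc[of _ l] square_mat_mult[of _ l])
  then show ?thesis
    unfolding equivalent_def using invertible_pair_mult[OF 1(1) 2(1)] invertible_pair_mult[OF 2(2) 1(2)] by blast
qed

section \<open>Permutation and elimination matrices\<close>

definition perm_mat :: "nat \<Rightarrow> (nat \<Rightarrow> nat) \<Rightarrow> 'k::field mat" where
  "perm_mat l p = mat l l (\<lambda>(i, j). if p i = j then 1 else 0)"

lemma perm_mat_mult_left:
  assumes A: "A \<in> carrier_mat l n" and p: "p permutes {..<l}"
  shows "perm_mat l p * A = mat l n (\<lambda>(i, j). A $$ (p i, j))" (is "_ = ?R")
proof (rule eq_matI)
  fix i j assume "i < dim_row ?R" "j < dim_col ?R"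
  then have ij: "i < l" "j < n" by simp_all
  have pi: "p i < l" using permutes_in_image[OF p, of i] ij(1) by simp
  have "(perm_mat l p * A) $$ (i, j) = (\<Sum>k<l. (if p i = k then 1 else 0) * A $$ (k, j))"
    using ij A by (simp add: perm_mat_def scalar_prod_def atLeast0LessThan)
  also have "\<dots> = (\<Sum>k<l. if k = p i then A $$ (p i, j) else 0)"
    by (rule sum.cong) auto
  also have "\<dots> = ?R $$ (i, j)" using pi ij by simp
  finally show "(perm_mat l p * A) $$ (i, j) = ?R $$ (i, j)" .
qed (use A in \<open>simp_all add: perm_mat_def\<close>)

lemma perm_mat_mult_right:
  assumes A: "A \<in> carrier_mat n l" and p: "p permutes {..<l}"
  shows "A * transpose_mat (perm_mat l p) = mat n l (\<lambda>(i, j). A $$ (i, p j))" (is "_ = ?R")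
proof (rule eq_matI)
  fix i j assume "i < dim_row ?R" "j < dim_col ?R"
  then have ij: "i < n" "j < l" by simp_all
  have pj: "p j < l" using permutes_in_image[OF p, of j] ij(2) by simp
  have "(A * transpose_mat (perm_mat l p)) $$ (i, j) = (\<Sum>k<l. A $$ (i, k) * (if p j = k then 1 else 0))"
    using ij A by (simp add: perm_mat_def scalar_prod_def atLeast0LessThan)
  also have "\<dots> = (\<Sum>k<l. if k = p j then A $$ (i, p j) else 0)"
    by (rule sum.cong) auto
  also have "\<dots> = ?R $$ (i, j)" using pj ij by simp
  finally show "(A * transpose_mat (perm_mat l p)) $$ (i, j) = ?R $$ (i, j)" .
qed (use A in \<open>simp_all add: perm_mat_def\<close>)

lemma invertible_perm_mat:
  assumes "p permutes {..<l}"
  shows "invertible_pair l (perm_mat l p) (transpose_mat (perm_mat l p))"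
proof (rule invertible_pairI)
  have "p j < l" if "j < l" for j using permutes_in_image[OF assms, of j] that by simp
  then show "perm_mat l p * transpose_mat (perm_mat l p) = 1\<^sub>m l"
    using assms permutes_inj[OF assms]
    by (subst perm_mat_mult_right[of _ l]) (auto intro!: eq_matI simp: perm_mat_def inj_eq)
qed (auto simp: perm_mat_def)

lemma invertible_pair_transpose:
  "invertible_pair l X X' \<Longrightarrow> invertible_pair l (transpose_mat X) (transpose_mat X')"
  unfolding invertible_pair_def by (metis transpose_carrier_mat transpose_mult transpose_one)

text \<open>An elementary elimination matrix: it scales row r by x r and adds x i times row r to
  every other row i.\<close>

definition replace_col :: "nat \<Rightarrow> nat \<Rightarrow> (nat \<Rightarrow> 'k) \<Rightarrow> 'k::field mat" where
  "replace_col l r x = mat l l (\<lambda>(i, j). if j = r then x i else if i = j then 1 else 0)"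

lemma replace_col_mult:
  assumes "A \<in> carrier_mat l n" "i < l" "j < n" "r < l"
  shows "(replace_col l r x * A) $$ (i, j) = (if i = r then 0 else A $$ (i, j)) + x i * A $$ (r, j)"
proof -
  have "(replace_col l r x * A) $$ (i, j) = (\<Sum>k<l. (if k = r then x i else if i = k then 1 else 0) * A $$ (k, j))"
    using assms by (simp add: replace_col_def scalar_prod_def atLeast0LessThan)
  also have "\<dots> = (\<Sum>k<l. (if k = r then x i * A $$ (r, j) else 0) + (if k = i then (if i = r then 0 else A $$ (i, j)) else 0))"
    by (rule sum.cong) auto
  also have "\<dots> = (if i = r then 0 else A $$ (i, j)) + x i * A $$ (r, j)"
    using assms by (simp add: sum.distrib)
  finally show ?thesis .
qed

lemma invertible_replace_col:
  assumes "r < l" "x r \<noteq> 0"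
  shows "invertible_pair l (replace_col l r x) (replace_col l r (\<lambda>i. if i = r then 1 / x r else - x i / x r))"
proof (rule invertible_pairI)
  let ?x' = "\<lambda>i. if i = r then 1 / x r else - x i / x r"
  show "replace_col l r x * replace_col l r ?x' = 1\<^sub>m l"
  proof (rule eq_matI)
    fix i j assume "i < dim_row (1\<^sub>m l :: 'a mat)" "j < dim_col (1\<^sub>m l :: 'a mat)"
    then have ij: "i < l" "j < l" by simp_all
    have "(replace_col l r x * replace_col l r ?x') $$ (i, j)
       = (if i = r then 0 else replace_col l r ?x' $$ (i, j)) + x i * replace_col l r ?x' $$ (r, j)"
      by (rule replace_col_mult) (use ij assms in \<open>auto simp: replace_col_def\<close>)
    also have "\<dots> = 1\<^sub>m l $$ (i, j)" using ij assms by (auto simp: replace_col_def)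
    finally show "(replace_col l r x * replace_col l r ?x') $$ (i, j) = 1\<^sub>m l $$ (i, j)" .
  qed (auto simp: replace_col_def)
qed (auto simp: replace_col_def)

text \<open>The pivots found so far are moved to the upper left corner by the permutations \<open>p\<close> and \<open>q\<close>.\<close>

lemma wedderburn_steps_equivalent:
  assumes C: "C \<in> carrier_mat l l" and "wedderburn_steps l C r D"
  shows "D \<in> carrier_mat l l \<and> r \<le> l \<and> (\<exists>p q. p permutes {..<l} \<and> q permutes {..<l} \<and>
    (\<forall>i<l. \<forall>j<l. i < r \<or> j < r \<longrightarrow> D $$ (p i, q j) = 0) \<and>
    equivalent l C (mat l l (\<lambda>(i, j). (if i = j \<and> i < r then 1 else 0) + D $$ (p i, q j))))"
  using assms(2)
proof induction
  case refl
  have "mat l l (\<lambda>(i, j). (if i = j \<and> i < 0 then 1 else 0) + C $$ (id i, id j)) = C"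
    using C by (intro eq_matI) auto
  then show ?case using C equivalent_refl[OF C] by (intro conjI exI[of _ id]) (auto simp: permutes_id[unfolded id_def])
next
  case (step r D i j)
  then obtain p q where D: "D \<in> carrier_mat l l" and pq: "p permutes {..<l}" "q permutes {..<l}"
    and zero: "\<And>i j. i < l \<Longrightarrow> j < l \<Longrightarrow> i < r \<or> j < r \<Longrightarrow> D $$ (p i, q j) = 0"
    and eqv: "equivalent l C (mat l l (\<lambda>(i, j). (if i = j \<and> i < r then 1 else 0) + D $$ (p i, q j)))"
    by blast
  have "i \<in> p ` {..<l}" "j \<in> q ` {..<l}" using step.hyps permutes_image[OF pq(1)] permutes_image[OF pq(2)] by auto
  then obtain i' j' where ij': "i' < l" "j' < l" "i = p i'" "j = q j'" by auto
  \<comment> \<open>The new pivot is nonzero, so it lies outside the rows and columns already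
    cleared.\<close>
  have r: "r \<le> i'" "r \<le> j'" using zero[OF ij'(1,2)] step.hyps ij' by (auto simp: not_less[symmetric])
  then have rl: "r < l" using ij' by simp
  \<comment> \<open>These transpositions bring the new pivot to place (r, r). They fix all indices
    below r and so leave the earlier pivots alone.\<close>
  define s t where st: "s = Transposition.transpose r i'" "t = Transposition.transpose r j'"
  have st_perm: "s permutes {..<l}" "t permutes {..<l}"
    unfolding st using rl ij' by (auto intro: permutes_swap_id)
  have st_small: "s k = k" "t k = k" if "k < r" for k
    using that r by (auto simp: st Transposition.transpose_def)
  have st_ge: "r \<le> s k" "r \<le> t k" if "r \<le> k" for k
    using that r by (auto simp: st Transposition.transpose_def)
  have st_l: "s k < l" "t k < l" if "k < l" for k
    using that permutes_in_image[OF st_perm(1), of k] permutes_in_image[OF st_perm(2), of k] by auto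
  have st_inv: "s (s k) = k" "t (t k) = k" for k by (simp_all add: st)
  define p' q' where p'q': "p' = p \<circ> s" "q' = q \<circ> t"
  have p'q'_perm: "p' permutes {..<l}" "q' permutes {..<l}"
    unfolding p'q' by (intro permutes_compose st_perm pq)+
  have p'r: "p' r = i" "q' r = j" by (simp_all add: p'q' st ij')
  have pl: "p' k < l" "q' k < l" if "k < l" for k
    using that permutes_in_image[OF p'q'_perm(1), of k] permutes_in_image[OF p'q'_perm(2), of k] by auto
  let ?N = "mat l l (\<lambda>(i, j). (if i = j \<and> i < r then 1 else 0) + D $$ (p i, q j))"
  let ?N1 = "mat l l (\<lambda>(i, j). (if i = j \<and> i < r then 1 else 0) + D $$ (p' i, q' j))"
  let ?W = "wedderburn i j D"
  let ?N2 = "mat l l (\<lambda>(i, j). (if i = j \<and> i < Suc r then 1 else 0) + ?W $$ (p' i, q' j))"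
  have zero': "D $$ (p' a, q' b) = 0" if "a < l" "b < l" "a < r \<or> b < r" for a b
    using that st_small zero[of "s a" "t b"] st_l by (auto simp: p'q')
  have W: "?W $$ (p' a, q' b) = D $$ (p' a, q' b) - D $$ (p' a, q' r) * D $$ (p' r, q' b) / D $$ (p' r, q' r)"
    if "a < l" "b < l" for a b
    using that pl D unfolding p'r by (simp add: wedderburn_def)
  have piv: "D $$ (p' r, q' r) \<noteq> 0" using step.hyps p'r by simp
  have W0: "?W $$ (p' a, q' b) = 0" if "a < l" "b < l" "a < Suc r \<or> b < Suc r" for a b
    using that zero'[OF that(1,2)] zero'[of a r] zero'[of r b] rl piv W[OF that(1,2)] by (auto simp: less_Suc_eq)
  have "equivalent l ?N ?N1"
    unfolding equivalent_def
  proof (intro exI conjI)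
    show "invertible_pair l (perm_mat l s) (transpose_mat (perm_mat l s))" by (rule invertible_perm_mat[OF st_perm(1)])
    show "invertible_pair l (transpose_mat (perm_mat l t)) (transpose_mat (transpose_mat (perm_mat l t)))"
      by (rule invertible_pair_transpose[OF invertible_perm_mat[OF st_perm(2)]])
    have "perm_mat l s * ?N1 * transpose_mat (perm_mat l t) = mat l l (\<lambda>(i, j). ?N1 $$ (s i, t j))"
      by (subst perm_mat_mult_left[of _ l l], simp, rule st_perm, subst perm_mat_mult_right[of _ l l], simp, rule st_perm)
        (auto intro!: eq_matI simp: st_l)
    also have "\<dots> = ?N"
    proof (rule eq_matI)
      fix a b assume "a < dim_row ?N" "b < dim_col ?N"
      then have ab: "a < l" "b < l" by simp_all
      have "s a = t b \<and> s a < r \<longleftrightarrow> a = b \<and> a < r"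
        using st_small st_ge by (metis not_less)
      then show "mat l l (\<lambda>(i, j). ?N1 $$ (s i, t j)) $$ (a, b) = ?N $$ (a, b)"
        using ab st_l st_inv by (simp add: p'q')
    qed auto
    finally show "?N = perm_mat l s * ?N1 * transpose_mat (perm_mat l t)" by simp
  qed
  \<comment> \<open>A reduction step removes a rank-one term x y^T, where x is the pivot column and
    y the pivot row divided by the pivot. Row r and column r of \<open>?N2\<close> are those of the
    identity, so elimination matrices with columns x and y on its two sides replace the 1 at (r, r)
    by x y^T and change nothing else.\<close>
  moreover have "equivalent l ?N1 ?N2"
    unfolding equivalent_def
  proof (intro exI conjI)
    let ?x = "\<lambda>a. D $$ (p' a, q' r)" and ?y = "\<lambda>b. D $$ (p' r, q' b) / D $$ (p' r, q' r)"
    show "invertible_pair l (replace_col l r ?x) (replace_col l r (\<lambda>i. if i = r then 1 / ?x r else - ?x i / ?x r))"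
      by (rule invertible_replace_col[where x = ?x]) (use rl piv in auto)
    show "invertible_pair l (transpose_mat (replace_col l r ?y)) (transpose_mat (replace_col l r (\<lambda>i. if i = r then 1 / ?y r else - ?y i / ?y r)))"
      by (rule invertible_pair_transpose[OF invertible_replace_col[where x = ?y]]) (use rl piv in auto)
    let ?P = "replace_col l r ?x * ?N2"
    have P: "?P $$ (a, b) = ?N2 $$ (a, b) - (if a = r then ?N2 $$ (r, b) else 0) + ?x a * ?N2 $$ (r, b)" if "a < l" "b < l" for a b
      using that rl by (subst replace_col_mult[of _ l l]) auto
    have N2r: "?N2 $$ (r, b) = (if b = r then 1 else 0)" "?N2 $$ (b, r) = (if b = r then 1 else 0)" if "b < l" for b
      using that rl W0 by auto
    have Pr: "?P $$ (a, r) = ?x a" if "a < l" for a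
      unfolding P[OF that rl] N2r(1)[OF rl] N2r(2)[OF that] by simp
    have "?N1 $$ (a, b) = (?P * transpose_mat (replace_col l r ?y)) $$ (a, b)" if ab: "a < l" "b < l" for a b
    proof -
      have "?P * transpose_mat (replace_col l r ?y) = transpose_mat (replace_col l r ?y * transpose_mat ?P)"
        by (subst transpose_mult[of _ l l _ l]) (auto simp: replace_col_def)
      then have "(?P * transpose_mat (replace_col l r ?y)) $$ (a, b) = (replace_col l r ?y * transpose_mat ?P) $$ (b, a)"
        using ab by (simp add: replace_col_def del: index_mult_mat(1))
      also have "\<dots> = (if b = r then 0 else transpose_mat ?P $$ (b, a)) + ?y b * transpose_mat ?P $$ (r, a)"
        by (rule replace_col_mult[of _ l l]) (use ab rl in \<open>auto simp: replace_col_def\<close>)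
      also have "\<dots> = (if b = r then 0 else ?P $$ (a, b)) + ?y b * ?P $$ (a, r)"
        using ab rl by (simp add: replace_col_def del: index_mult_mat(1))
      also have "\<dots> = ?N1 $$ (a, b)"
      proof (cases "b = r")
        case True
        then show ?thesis using ab rl piv Pr[OF ab(1)] by simp
      next
        case False
        have "?P $$ (a, b) = ?N2 $$ (a, b)" unfolding P[OF ab] N2r(1)[OF ab(2)] using False by simp
        also have "\<dots> = (if a = b \<and> a < Suc r then 1 else 0) + ?W $$ (p' a, q' b)" using ab by simp
        also have "a = b \<and> a < Suc r \<longleftrightarrow> a = b \<and> a < r" using False by auto
        finally show ?thesis using False Pr[OF ab(1)] ab W[OF ab] by (simp del: index_mult_mat(1))
      qed
      finally show ?thesis by simp
    qed
    then show "?N1 = ?P * transpose_mat (replace_col l r ?y)"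
      by (intro eq_matI) (auto simp: replace_col_def)
  qed
  ultimately have "equivalent l C ?N2"
    using equivalent_trans[OF equivalent_trans[OF eqv]] by simp
  moreover have "?W \<in> carrier_mat l l" using D by (simp add: wedderburn_def)
  ultimately show ?case using rl p'q'_perm W0 by (intro conjI exI[of _ p'] exI[of _ q']) auto
qed

lemma wedderburn_steps_zero:
  assumes C: "C \<in> carrier_mat l l" and steps: "wedderburn_steps l C r D" and "\<And>i j. i < l \<Longrightarrow> j < l \<Longrightarrow> D $$ (i, j) = 0"
  shows "r \<le> l" "equivalent l C (idem l r)"
proof -
  from wedderburn_steps_equivalent[OF C steps] obtain p q where
    *: "r \<le> l" "p permutes {..<l}" "q permutes {..<l}"
    "equivalent l C (mat l l (\<lambda>(i, j). (if i = j \<and> i < r then 1 else 0) + D $$ (p i, q j)))" by blast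
  have "mat l l (\<lambda>(i, j). (if i = j \<and> i < r then 1 else 0) + D $$ (p i, q j)) = idem l r"
    using permutes_in_image[OF *(2)] permutes_in_image[OF *(3)] assms(3)
    by (intro eq_matI) (auto simp: idem_def mat_diag_def)
  then show "r \<le> l" "equivalent l C (idem l r)" using * by simp_all
qed

section \<open>The rank program\<close>

text \<open>A Hoare triple for total correctness with a bound on the number of steps.\<close>

definition valid :: "(regs \<Rightarrow> 'k::field cells \<Rightarrow> bool) \<Rightarrow> prog \<Rightarrow> (regs \<Rightarrow> 'k cells \<Rightarrow> bool) \<Rightarrow> nat \<Rightarrow> bool" where
  "valid P c Q n \<longleftrightarrow> (\<forall>R M. P R M \<longrightarrow> (\<exists>k \<le> n. \<exists>R' M'. exec c (R, M) k (R', M') \<and> Q R' M'))"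

section \<open>Proof rules with step counts\<close>

lemma valid_consequence:
  "valid P c Q n \<Longrightarrow> (\<And>R M. P' R M \<Longrightarrow> P R M) \<Longrightarrow> (\<And>R M. Q R M \<Longrightarrow> Q' R M) \<Longrightarrow> valid P' c Q' n"
  unfolding valid_def by meson

lemma valid_Skip: "(\<And>R M. P R M \<Longrightarrow> Q R M) \<Longrightarrow> valid P Skip Q 0"
  unfolding valid_def using exec.Skip by blast

lemma valid_Set_Reg: "(\<And>R M. P R M \<Longrightarrow> Q (R(x := aval R a)) M) \<Longrightarrow> valid P (Set_Reg x a) Q 1"
  unfolding valid_def using exec.Set_Reg by blast

lemma valid_Set_Cell:
  "(\<And>R M. P R M \<Longrightarrow> \<exists>v. fval (R, M) e = Some v \<and> Q R (M(addr R u := v))) \<Longrightarrow> valid P (Set_Cell u e) Q 1"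
  unfolding valid_def using exec.Set_Cell by blast

lemma valid_Seq:
  assumes "valid P c Q m" "valid Q d S n"
  shows "valid P (Seq c d) S (m + n)"
  unfolding valid_def
proof (intro allI impI)
  fix R M assume "P R M"
  then obtain k R' M' where 1: "k \<le> m" "exec c (R, M) k (R', M')" "Q R' M'"
    using assms(1) unfolding valid_def by blast
  then obtain k' R'' M'' where 2: "k' \<le> n" "exec d (R', M') k' (R'', M'')" "S R'' M''"
    using assms(2) unfolding valid_def by blast
  show "\<exists>k\<le>m + n. \<exists>R' M'. exec (Seq c d) (R, M) k (R', M') \<and> S R' M'"
    using exec.Seq[OF 1(2) 2(2)] 1(1) 2(1,3) by (meson add_mono)
qed

lemma valid_If:
  assumes "valid (\<lambda>R M. P R M \<and> holds (R, M) b) c Q n" "valid (\<lambda>R M. P R M \<and> \<not> holds (R, M) b) d Q n"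
  shows "valid P (If b c d) Q (Suc n)"
  unfolding valid_def
proof (intro allI impI)
  fix R M assume P: "P R M"
  show "\<exists>k\<le>Suc n. \<exists>R' M'. exec (If b c d) (R, M) k (R', M') \<and> Q R' M'"
  proof (cases "holds (R, M) b")
    case True
    then show ?thesis using P assms(1) exec.If_True[OF True] unfolding valid_def by (meson Suc_le_mono)
  next
    case False
    then show ?thesis using P assms(2) exec.If_False[OF False] unfolding valid_def by (meson Suc_le_mono)
  qed
qed

lemma valid_mono: "valid P c Q m \<Longrightarrow> m \<le> n \<Longrightarrow> valid P c Q n"
  unfolding valid_def by (meson le_trans)

definition for_loop :: "nat \<Rightarrow> prog \<Rightarrow> prog" where
  "for_loop x c = Seq (Set_Reg x (Num 0))
     (While (Less (Reg x) (Reg 0)) (Seq c (Set_Reg x (Plus (Reg x) (Num 1)))))"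

text \<open>Each round costs the test, the body and the increment; the initialization and the
  failing last test give the extra 2. The body must establish the invariant for the counter already
  advanced, because the increment follows it. The counter differs from register 0, so the bound l
  survives.\<close>

lemma valid_for_loop:
  assumes body: "\<And>k. k < l \<Longrightarrow> valid (\<lambda>R M. I k R M \<and> R x = k \<and> R 0 = l) c
      (\<lambda>R M. I (Suc k) (R(x := Suc k)) M \<and> R x = k \<and> R 0 = l) n"
    and init: "\<And>R M. P R M \<Longrightarrow> I 0 (R(x := 0)) M \<and> R 0 = l"
    and final: "\<And>R M. I l R M \<and> R x = l \<and> R 0 = l \<Longrightarrow> Q R M" and x: "x \<noteq> 0"
  shows "valid P (for_loop x c) Q (2 + l * (n + 2))"
proof -
  let ?w = "While (Less (Reg x) (Reg 0)) (Seq c (Set_Reg x (Plus (Reg x) (Num 1))))"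
  \<comment> \<open>The induction is on the number j of rounds still to run.\<close>
  have loop: "valid (\<lambda>R M. I (l - j) R M \<and> R x = l - j \<and> R 0 = l) ?w (\<lambda>R M. I l R M \<and> R x = l \<and> R 0 = l) (1 + j * (n + 2))"
    if "j \<le> l" for j
    using that
  proof (induction j)
    case 0
    show ?case unfolding valid_def
    proof (intro allI impI)
      fix R M assume I: "I (l - 0) R M \<and> R x = l - 0 \<and> R 0 = l"
      then have "\<not> holds (R, M) (Less (Reg x) (Reg 0))" by simp
      from exec.While_False[OF this] have "exec ?w (R, M) 1 (R, M)" .
      then show "\<exists>k\<le>1 + 0 * (n + 2). \<exists>R' M'. exec ?w (R, M) k (R', M') \<and> I l R' M' \<and> R' x = l \<and> R' 0 = l"
        using I by auto
    qed
  next
    case (Suc j)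
    let ?k = "l - Suc j"
    have k: "?k < l" "l - j = Suc ?k" using Suc.prems by auto
    have IH: "valid (\<lambda>R M. I (Suc ?k) R M \<and> R x = Suc ?k \<and> R 0 = l) ?w (\<lambda>R M. I l R M \<and> R x = l \<and> R 0 = l) (1 + j * (n + 2))"
      using Suc.IH Suc.prems k(2) by simp
    have step: "valid (\<lambda>R M. I ?k R M \<and> R x = ?k \<and> R 0 = l) (Seq c (Set_Reg x (Plus (Reg x) (Num 1))))
       (\<lambda>R M. I (Suc ?k) R M \<and> R x = Suc ?k \<and> R 0 = l) (n + 1)"
      by (rule valid_Seq[OF body[OF k(1)]], rule valid_Set_Reg) (use x in auto)
    show ?case unfolding valid_def
    proof (intro allI impI)
      fix R M assume P: "I ?k R M \<and> R x = ?k \<and> R 0 = l"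
      then have b: "holds (R, M) (Less (Reg x) (Reg 0))" using k by simp
      obtain m1 R1 M1 where 1: "m1 \<le> n + 1" "exec (Seq c (Set_Reg x (Plus (Reg x) (Num 1)))) (R, M) m1 (R1, M1)"
        "I (Suc ?k) R1 M1 \<and> R1 x = Suc ?k \<and> R1 0 = l"
        using step P unfolding valid_def by blast
      obtain m2 R2 M2 where 2: "m2 \<le> 1 + j * (n + 2)" "exec ?w (R1, M1) m2 (R2, M2)"
        "I l R2 M2 \<and> R2 x = l \<and> R2 0 = l"
        using IH 1(3) unfolding valid_def by blast
      have "Suc (m1 + m2) \<le> 1 + Suc j * (n + 2)" using 1(1) 2(1) by simp
      then show "\<exists>k\<le>1 + Suc j * (n + 2). \<exists>R' M'. exec ?w (R, M) k (R', M') \<and> I l R' M' \<and> R' x = l \<and> R' 0 = l"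
        using exec.While_True[OF b 1(2) 2(2)] 2(3) by blast
    qed
  qed
  have "valid P (for_loop x c) (\<lambda>R M. I l R M \<and> R x = l \<and> R 0 = l) (1 + (1 + l * (n + 2)))"
    unfolding for_loop_def
    by (rule valid_Seq[OF valid_Set_Reg loop[OF order.refl]]) (use init x in auto)
  then show ?thesis using final valid_consequence[of P _ _ "2 + l * (n + 2)" P Q] by simp
qed

section \<open>The program and its memory layout\<close>

definition entry :: "nat \<Rightarrow> nat \<Rightarrow> nat \<Rightarrow> loc" where
  "entry s x y = Cell (Plus (Plus (Num s) (Reg 0)) (Reg x)) (Plus (Num s) (Reg y))"

text \<open>Cells 0, ..., l - 1 of the scratch row save the scaled pivot row, the next l cells the
  pivot column, and cell 2l a product. The copies are necessary because the update overwrites the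
  pivot row and column while they are still needed.\<close>

definition row_temp :: loc where "row_temp = Cell (Num 0) (Reg 4)"
definition pivot_temp :: loc where "pivot_temp = Cell (Num 0) (Reg 2)"
definition col_temp :: loc where "col_temp = Cell (Num 0) (Plus (Reg 0) (Reg 3))"
definition prod_temp :: loc where "prod_temp = Cell (Num 0) (Plus (Reg 0) (Reg 0))"

text \<open>Register 0 holds \<open>l\<close>, registers 1 and 2 the pivot position, 3 and 4 a running position, 5 the
  number of pivots. Cell row 0 lies outside the block and serves as scratch space. Since the scaled
  pivot row has entry 1 in the pivot column, dividing by it copies the pivot column.\<close>

definition reduce_prog :: "nat \<Rightarrow> prog" where
  "reduce_prog s = Seq (for_loop 4 (Set_Cell row_temp (Op Div (entry s 1 4) (entry s 1 2))))
     (Seq (for_loop 3 (Set_Cell col_temp (Op Div (entry s 3 2) pivot_temp)))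
       (for_loop 3 (for_loop 4 (Seq (Set_Cell prod_temp (Op Mul col_temp row_temp))
          (Set_Cell (entry s 3 4) (Op Sub (entry s 3 4) prod_temp))))))"

definition rank_prog :: "nat \<Rightarrow> prog" where
  "rank_prog s = Seq (for_loop 1 (for_loop 2 (If (Is_Zero (entry s 1 2)) Skip
     (Seq (Set_Reg 5 (Plus (Reg 5) (Num 1))) (reduce_prog s))))) (Set_Reg 0 (Reg 5))"

definition block :: "nat \<Rightarrow> nat \<Rightarrow> 'k::field cells \<Rightarrow> 'k mat" where
  "block s l M = mat l l (\<lambda>(a, b). M (s + l + a, s + b))"

definition reduce_cost :: "nat \<Rightarrow> nat" where
  "reduce_cost l = (2 + l * 3) + ((2 + l * 3) + (2 + l * ((2 + l * 4) + 2)))"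

lemma valid_reduce_prog:
  assumes ij: "i < l" "j < l"
  shows "valid (\<lambda>R M. R 0 = l \<and> R 1 = i \<and> R 2 = j \<and> R 5 = r \<and> block s l M = C \<and> C $$ (i, j) \<noteq> (0 :: 'k::field))
     (reduce_prog s) (\<lambda>R M. R 0 = l \<and> R 1 = i \<and> R 2 = j \<and> R 5 = r \<and> block s l M = wedderburn i j C)
     (reduce_cost l)"
proof -
  have l: "0 < l" using ij by simp
  let ?B = "\<lambda>R M. R 0 = l \<and> R 1 = i \<and> R 2 = j \<and> R (5 :: nat) = r \<and> C $$ (i, j) \<noteq> 0 \<and> C \<in> carrier_mat l l"
  let ?S = "\<lambda>M :: 'k cells. \<forall>a<l. \<forall>b<l. M (s + l + a, s + b) = C $$ (a, b)"
  let ?T = "\<lambda>k (M :: 'k cells). \<forall>b<k. M (0, b) = C $$ (i, b) / C $$ (i, j)"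
  let ?U = "\<lambda>k (M :: 'k cells). \<forall>a<k. M (0, l + a) = C $$ (a, j)"
  let ?E = "\<lambda>a b. C $$ (a, b) - C $$ (a, j) * (C $$ (i, b) / C $$ (i, j))"
  \<comment> \<open>Positions before (k, k') in reading order are already updated. The new values
    refer to the original C, which the saved row and column make available throughout the
    update.\<close>
  let ?V = "\<lambda>k k' (M :: 'k cells). \<forall>a<l. \<forall>b<l. M (s + l + a, s + b) = (if a < k \<or> a = k \<and> b < k' then ?E a b else C $$ (a, b))"
  note defs = entry_def row_temp_def pivot_temp_def col_temp_def prod_temp_def
  have 1: "valid (\<lambda>R M. R 0 = l \<and> R 1 = i \<and> R 2 = j \<and> R 5 = r \<and> block s l M = C \<and> C $$ (i, j) \<noteq> (0 :: 'k::field))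
     (for_loop 4 (Set_Cell row_temp (Op Div (entry s 1 4) (entry s 1 2))))
     (\<lambda>R M. (?B R M \<and> ?S M \<and> ?T l M) \<and> R 4 = l \<and> R 0 = l) (2 + l * (1 + 2))"
    by (rule valid_for_loop[where I = "\<lambda>k R M. ?B R M \<and> ?S M \<and> ?T k M"], rule valid_Set_Cell)
      (use ij in \<open>auto simp: defs block_def less_Suc_eq\<close>)
  have 2: "valid (\<lambda>R M. (?B R M \<and> ?S M \<and> ?T l M) \<and> R 4 = l \<and> R 0 = l)
     (for_loop 3 (Set_Cell col_temp (Op Div (entry s 3 2) pivot_temp)))
     (\<lambda>R M. (?B R M \<and> ?S M \<and> ?T l M \<and> ?U l M) \<and> R 3 = l \<and> R 0 = l) (2 + l * (1 + 2))"
    by (rule valid_for_loop[where I = "\<lambda>k R M. ?B R M \<and> ?S M \<and> ?T l M \<and> ?U k M"], rule valid_Set_Cell)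
      (use ij in \<open>auto simp: defs less_Suc_eq\<close>)
  have inner: "valid (\<lambda>R M. (?B R M \<and> ?V k k' M \<and> ?T l M \<and> ?U l M \<and> R 3 = k) \<and> R 4 = k' \<and> R 0 = l)
      (Seq (Set_Cell prod_temp (Op Mul col_temp row_temp))
          (Set_Cell (entry s 3 4) (Op Sub (entry s 3 4) prod_temp)))
      (\<lambda>R M. (?B (R(4 := Suc k')) M \<and> ?V k (Suc k') M \<and> ?T l M \<and> ?U l M \<and> (R(4 := Suc k')) 3 = k) \<and> R 4 = k' \<and> R 0 = l) (1 + 1)"
    if k: "k < l" "k' < l" for k k'
  proof (rule valid_Seq)
    show "valid (\<lambda>R M. (?B R M \<and> ?V k k' M \<and> ?T l M \<and> ?U l M \<and> R 3 = k) \<and> R 4 = k' \<and> R 0 = l)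
      (Set_Cell prod_temp (Op Mul col_temp row_temp))
      (\<lambda>R M. (?B R M \<and> ?V k k' M \<and> ?T l M \<and> ?U l M \<and> R 3 = k) \<and> R 4 = k' \<and> R 0 = l \<and>
         M (0, l + l) = C $$ (k, j) * (C $$ (i, k') / C $$ (i, j))) 1"
      by (rule valid_Set_Cell) (use k in \<open>auto simp: defs\<close>)
    show "valid (\<lambda>R M. (?B R M \<and> ?V k k' M \<and> ?T l M \<and> ?U l M \<and> R 3 = k) \<and> R 4 = k' \<and> R 0 = l \<and>
         M (0, l + l) = C $$ (k, j) * (C $$ (i, k') / C $$ (i, j)))
      (Set_Cell (entry s 3 4) (Op Sub (entry s 3 4) prod_temp))
      (\<lambda>R M. (?B (R(4 := Suc k')) M \<and> ?V k (Suc k') M \<and> ?T l M \<and> ?U l M \<and> (R(4 := Suc k')) 3 = k) \<and> R 4 = k' \<and> R 0 = l) 1"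
      by (rule valid_Set_Cell) (use k in \<open>auto simp: defs less_Suc_eq\<close>)
  qed
  have 3: "valid (\<lambda>R M. (?B R M \<and> ?S M \<and> ?T l M \<and> ?U l M) \<and> R 3 = l \<and> R 0 = l)
     (for_loop 3 (for_loop 4 (Seq (Set_Cell prod_temp (Op Mul col_temp row_temp))
          (Set_Cell (entry s 3 4) (Op Sub (entry s 3 4) prod_temp)))))
     (\<lambda>R M. (?B R M \<and> ?V l 0 M \<and> ?T l M \<and> ?U l M) \<and> R 3 = l \<and> R 0 = l) (2 + l * ((2 + l * ((1 + 1) + 2)) + 2))"
  proof (rule valid_for_loop[where I = "\<lambda>k R M. ?B R M \<and> ?V k 0 M \<and> ?T l M \<and> ?U l M"])
    fix k assume k: "k < l"
    show "valid (\<lambda>R M. (?B R M \<and> ?V k 0 M \<and> ?T l M \<and> ?U l M) \<and> R 3 = k \<and> R 0 = l)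
       (for_loop 4 (Seq (Set_Cell prod_temp (Op Mul col_temp row_temp))
          (Set_Cell (entry s 3 4) (Op Sub (entry s 3 4) prod_temp))))
       (\<lambda>R M. (?B (R(3 := Suc k)) M \<and> ?V (Suc k) 0 M \<and> ?T l M \<and> ?U l M) \<and> R 3 = k \<and> R 0 = l)
       (2 + l * ((1 + 1) + 2))"
    proof (rule valid_for_loop[where I = "\<lambda>k' R M. ?B R M \<and> ?V k k' M \<and> ?T l M \<and> ?U l M \<and> R 3 = k"])
      show "valid (\<lambda>R M. (?B R M \<and> ?V k k' M \<and> ?T l M \<and> ?U l M \<and> R 3 = k) \<and> R 4 = k' \<and> R 0 = l)
        (Seq (Set_Cell prod_temp (Op Mul col_temp row_temp)) (Set_Cell (entry s 3 4) (Op Sub (entry s 3 4) prod_temp)))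
        (\<lambda>R M. (?B (R(4 := Suc k')) M \<and> ?V k (Suc k') M \<and> ?T l M \<and> ?U l M \<and> (R(4 := Suc k')) 3 = k) \<and> R 4 = k' \<and> R 0 = l) (1 + 1)"
        if "k' < l" for k'
        by (rule inner[OF k that])
    qed (auto simp: less_Suc_eq)
  qed auto
  have "valid (\<lambda>R M. R 0 = l \<and> R 1 = i \<and> R 2 = j \<and> R 5 = r \<and> block s l M = C \<and> C $$ (i, j) \<noteq> (0 :: 'k::field))
     (reduce_prog s) (\<lambda>R M. (?B R M \<and> ?V l 0 M \<and> ?T l M \<and> ?U l M) \<and> R 3 = l \<and> R 0 = l) (reduce_cost l)"
    unfolding reduce_prog_def reduce_cost_def
    using valid_Seq[OF 1 valid_Seq[OF 2 3]] by (simp add: numeral_eq_Suc)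
  then show ?thesis
    by (rule valid_consequence) (auto simp: block_def wedderburn_def intro!: eq_matI)
qed

text \<open>Mirrors the loop nesting: \<open>c q\<close> is the cost of a loop over l with body cost
  q. The inner [:2:] pays for the zero test and the pivot counter, the final [:1:] for moving the
  count to register 0. The degree is 4.\<close>

definition rank_poly :: "nat poly" where
  "rank_poly = (let x = [:0, 1:]; c = (\<lambda>q. [:2:] + x * (q + [:2:])) in
     c (c ([:2:] + (c [:1:] + (c [:1:] + c (c [:2:]))))) + [:1:])"

lemma valid_rank_prog:
  fixes C :: "'k::field mat"
  shows "valid (\<lambda>R M. R 0 = l \<and> R 5 = 0 \<and> block s l M = C) (rank_prog s)
     (\<lambda>R M. \<exists>D. wedderburn_steps l C (R 0) D \<and> (\<forall>i<l. \<forall>j<l. D $$ (i, j) = 0)) (poly rank_poly l)"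
proof -
  let ?I = "\<lambda>k k' (R :: regs) (M :: 'k cells). R 0 = l \<and> wedderburn_steps l C (R 5) (block s l M) \<and>
     (\<forall>i<l. \<forall>j<l. i < k \<or> i = k \<and> j < k' \<longrightarrow> block s l M $$ (i, j) = 0)"
  have dims: "dim_row (block s l M) = l" "dim_col (block s l M) = l" for M :: "'k cells"
    by (simp_all add: block_def)
  have body: "valid (\<lambda>R M. (?I k k' R M \<and> R 1 = k) \<and> R 2 = k' \<and> R 0 = l)
     (If (Is_Zero (entry s 1 2)) Skip (Seq (Set_Reg 5 (Plus (Reg 5) (Num 1))) (reduce_prog s)))
     (\<lambda>R M. (?I k (Suc k') (R(2 := Suc k')) M \<and> (R(2 := Suc k')) 1 = k) \<and> R 2 = k' \<and> R 0 = l) (Suc (1 + reduce_cost l))"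
    if k: "k < l" "k' < l" for k k'
  proof (rule valid_If)
    show "valid (\<lambda>R M. ((?I k k' R M \<and> R 1 = k) \<and> R 2 = k' \<and> R 0 = l) \<and> holds (R, M) (Is_Zero (entry s 1 2))) Skip
      (\<lambda>R M. (?I k (Suc k') (R(2 := Suc k')) M \<and> (R(2 := Suc k')) 1 = k) \<and> R 2 = k' \<and> R 0 = l) (1 + reduce_cost l)"
      by (rule valid_mono[OF valid_Skip]) (use k in \<open>auto simp: entry_def block_def less_Suc_eq\<close>)
    show "valid (\<lambda>R M. ((?I k k' R M \<and> R 1 = k) \<and> R 2 = k' \<and> R 0 = l) \<and> \<not> holds (R, M) (Is_Zero (entry s 1 2)))
      (Seq (Set_Reg 5 (Plus (Reg 5) (Num 1))) (reduce_prog s))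
      (\<lambda>R M. (?I k (Suc k') (R(2 := Suc k')) M \<and> (R(2 := Suc k')) 1 = k) \<and> R 2 = k' \<and> R 0 = l) (1 + reduce_cost l)"
      \<comment> \<open>The triple is opened at a fixed state, since the matrix for which
        \<open>valid_reduce_prog\<close> is instantiated is the block of that state.\<close>
      unfolding valid_def
    proof (intro allI impI)
      fix R :: regs and M :: "'k cells"
      assume pre: "((?I k k' R M \<and> R 1 = k) \<and> R 2 = k' \<and> R 0 = l) \<and> \<not> holds (R, M) (Is_Zero (entry s 1 2))"
      let ?D = "block s l M"
      have piv: "?D $$ (k, k') \<noteq> 0" using pre k by (auto simp: entry_def block_def)
      have steps: "wedderburn_steps l C (Suc (R 5)) (wedderburn k k' ?D)"
        using pre piv k by (intro wedderburn_steps.step) auto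
      \<comment> \<open>Visited zeros survive the correction: in an earlier row its factor from
        column k' is zero, and in row k its factor from the pivot row is zero. The pivot itself
        cancels.\<close>
      have zero: "wedderburn k k' ?D $$ (i, j) = 0" if "i < l" "j < l" "i < k \<or> i = k \<and> j < Suc k'" for i j
        using that pre piv k by (auto simp: wedderburn_def dims less_Suc_eq)
      have 1: "valid (\<lambda>R' M'. R' = R \<and> M' = M) (Set_Reg 5 (Plus (Reg 5) (Num 1)))
        (\<lambda>R' M'. R' 0 = l \<and> R' 1 = k \<and> R' 2 = k' \<and> R' 5 = Suc (R 5) \<and> block s l M' = ?D \<and> ?D $$ (k, k') \<noteq> 0) 1"
        by (rule valid_Set_Reg) (use pre piv in auto)
      obtain n R' M' where "n \<le> 1 + reduce_cost l"
        "exec (Seq (Set_Reg 5 (Plus (Reg 5) (Num 1))) (reduce_prog s)) (R, M) n (R', M')"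
        "R' 0 = l \<and> R' 1 = k \<and> R' 2 = k' \<and> R' 5 = Suc (R 5) \<and> block s l M' = wedderburn k k' ?D"
        using valid_Seq[OF 1 valid_reduce_prog[OF k]] unfolding valid_def by blast
      then show "\<exists>n\<le>1 + reduce_cost l. \<exists>R' M'.
          exec (Seq (Set_Reg 5 (Plus (Reg 5) (Num 1))) (reduce_prog s)) (R, M) n (R', M') \<and>
          (?I k (Suc k') (R'(2 := Suc k')) M' \<and> (R'(2 := Suc k')) 1 = k) \<and> R' 2 = k' \<and> R' 0 = l"
        using steps zero by (intro exI[of _ n] conjI exI[of _ R'] exI[of _ M']) auto
    qed
  qed
  have "valid (\<lambda>R M. R 0 = l \<and> R 5 = 0 \<and> block s l M = C) (for_loop 1 (for_loop 2 (If (Is_Zero (entry s 1 2)) Skip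
     (Seq (Set_Reg 5 (Plus (Reg 5) (Num 1))) (reduce_prog s)))))
     (\<lambda>R M. ?I l 0 R M \<and> R 1 = l \<and> R 0 = l) (2 + l * ((2 + l * (Suc (1 + reduce_cost l) + 2)) + 2))"
  proof (rule valid_for_loop[where I = "\<lambda>k R M. ?I k 0 R M"])
    fix k assume k: "k < l"
    show "valid (\<lambda>R M. ?I k 0 R M \<and> R 1 = k \<and> R 0 = l)
       (for_loop 2 (If (Is_Zero (entry s 1 2)) Skip (Seq (Set_Reg 5 (Plus (Reg 5) (Num 1))) (reduce_prog s))))
       (\<lambda>R M. ?I (Suc k) 0 (R(1 := Suc k)) M \<and> R 1 = k \<and> R 0 = l) (2 + l * (Suc (1 + reduce_cost l) + 2))"
      by (rule valid_for_loop[where I = "\<lambda>k' R M. ?I k k' R M \<and> R 1 = k"], rule body[OF k])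
        (auto simp: less_Suc_eq)
  qed (auto intro: wedderburn_steps.refl)
  then have "valid (\<lambda>R M. R 0 = l \<and> R 5 = 0 \<and> block s l M = C) (rank_prog s)
     (\<lambda>R M. \<exists>D. wedderburn_steps l C (R 0) D \<and> (\<forall>i<l. \<forall>j<l. D $$ (i, j) = 0))
     ((2 + l * ((2 + l * (Suc (1 + reduce_cost l) + 2)) + 2)) + 1)"
    unfolding rank_prog_def by (rule valid_Seq[OF _ valid_Set_Reg]) auto
  moreover have "(2 + l * ((2 + l * (Suc (1 + reduce_cost l) + 2)) + 2)) + 1 = poly rank_poly l"
    by (simp add: rank_poly_def reduce_cost_def Let_def algebra_simps)
  ultimately show ?thesis by simp
qed

section \<open>Distinctness of the \<omega>_r and the output of the program\<close>

lemma two_neq_zero_of_odd_CHAR: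
  assumes "odd CHAR('k::field)"
  shows "(2 :: 'k) \<noteq> 0"
proof
  assume "(2 :: 'k) = 0"
  then have "of_nat 2 = (0 :: 'k)" by simp
  then have "CHAR('k) dvd 2" by (simp only: of_nat_eq_0_iff_char_dvd)
  then have "CHAR('k) \<le> 2" by (rule dvd_imp_le) simp
  moreover have "CHAR('k) \<noteq> 2" "CHAR('k) \<noteq> 0" using assms odd_pos by auto
  ultimately have "CHAR('k) = 1" by linarith
  then show False by simp
qed

lemma omega_isometry:
  assumes two: "(2 :: 'k::field) \<noteq> 0" and "r \<le> l"
  shows "(omega F l r :: 'k mat) \<in> isometry_group F l"
  unfolding omega_eq_flip[OF assms(2)]
  by (rule flip_isometry[OF two]) (simp_all add: power_mult_distrib[symmetric])

lemma omega_lower_block: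
  assumes "r \<le> l"
  shows "mat l l (\<lambda>(i, j). (omega F l r :: 'k::field mat) $$ (mid F + l + i, mid F + j))
    = mat_diag l (\<lambda>i. if i < r then omega_lower F else 0)"
  unfolding omega_eq_flip[OF assms] flip_def
  by (rule eq_matI) (auto simp: blk_def)

lemma inj_on_omega: "inj_on (omega F l :: nat \<Rightarrow> 'k::field mat) {..l}"
proof (rule linorder_inj_onI')
  fix r s assume rs: "r \<in> {..l}" "s \<in> {..l}" "r < s"
  show "(omega F l r :: 'k mat) \<noteq> omega F l s"
  proof
    assume "(omega F l r :: 'k mat) = omega F l s"
    then have "mat_diag l (\<lambda>i. if i < r then omega_lower F else 0 :: 'k) = mat_diag l (\<lambda>i. if i < s then omega_lower F else 0)"
      using omega_lower_block[of r l F, where ?'k = 'k] omega_lower_block[of s l F, where ?'k = 'k] rs by simp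
    \<comment> \<open>Place r is the first one where the two diagonals differ.\<close>
    from arg_cong[OF this, of "\<lambda>A. A $$ (r, r)"] show False
      using rs by (simp add: mat_diag_index omega_lower_def split: if_splits)
  qed
qed

lemma rank_prog_run:
  fixes g :: "'k::field mat"
  assumes g: "g \<in> isometry_group F l"
  obtains n R M X X' Y Y' where "exec (rank_prog (mid F)) (input l g) n (R, M)" "n \<le> poly rank_poly l" "R 0 \<le> l"
    "invertible_pair l X X'" "invertible_pair l Y Y'"
    "mat l l (\<lambda>(i, j). g $$ (mid F + l + i, mid F + j)) = X * idem l (R 0) * Y"
proof -
  let ?C = "mat l l (\<lambda>(i, j). g $$ (mid F + l + i, mid F + j))"
  note gc = isometry_group_carrier[OF g]
  obtain R0 M0 where in0: "input l g = (R0, M0)" by (cases "input l g")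
  then have "R0 0 = l \<and> R0 5 = 0 \<and> block (mid F) l M0 = ?C"
    using gc by (auto simp: input_def block_def dimn_eq)
  then obtain n R M D where run: "n \<le> poly rank_poly l" "exec (rank_prog (mid F)) (input l g) n (R, M)"
    "wedderburn_steps l ?C (R 0) D" "\<forall>i<l. \<forall>j<l. D $$ (i, j) = 0"
    using valid_rank_prog[of l "mid F" ?C] unfolding valid_def in0 by blast
  from wedderburn_steps_zero[OF _ run(3)] run(4) have "R 0 \<le> l" "equivalent l ?C (idem l (R 0))" by simp_all
  then show ?thesis using that run(1,2) unfolding equivalent_def by blast
qed

theorem theorem7p1:
  fixes F :: family
  assumes "odd CHAR('k::field)"
  shows "(\<exists>(c :: prog) (p :: nat poly). \<forall>l.
            (\<forall>g \<in> (isometry_group F l :: 'k mat set). \<exists>n \<omega>.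
               determines c F l g n \<omega> \<and> n \<le> poly p l \<and>
               \<omega> \<in> W_hat F l \<and> g \<in> double_coset (siegel_parabolic F l) \<omega>) \<and>
            {\<omega>. \<exists>g \<in> (isometry_group F l :: 'k mat set). \<exists>n. determines c F l g n \<omega>} = W_hat F l) \<and>
         (\<forall>l. finite (W_hat F l :: 'k mat set) \<and> card (W_hat F l :: 'k mat set) = l + 1)"
\<comment> \<open>The program depends on the family only through the offset \<open>mid F\<close> and
  reads l from register 0, so one program text and one polynomial serve all ranks.\<close>
proof (intro conjI allI ballI exI[of _ "rank_prog (mid F)"] exI[of _ rank_poly])
  have two: "(2 :: 'k) \<noteq> 0" by (rule two_neq_zero_of_odd_CHAR[OF assms])
  show "\<exists>n \<omega>. determines (rank_prog (mid F)) F l g n \<omega> \<and> n \<le> poly rank_poly l \<and>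
      \<omega> \<in> W_hat F l \<and> g \<in> double_coset (siegel_parabolic F l) \<omega>"
    if g: "g \<in> isometry_group F l" for l and g :: "'k mat"
  proof -
    from rank_prog_run[OF g] obtain n R M X X' Y Y' where
      run: "exec (rank_prog (mid F)) (input l g) n (R, M)" "n \<le> poly rank_poly l" "R 0 \<le> l"
      and XY: "invertible_pair l X X'" "invertible_pair l Y Y'"
      and C: "mat l l (\<lambda>(i, j). g $$ (mid F + l + i, mid F + j)) = X * idem l (R 0) * Y" .
    have "g \<in> double_coset (siegel_parabolic F l) (omega F l (R 0))"
      using XY unfolding invertible_pair_def
      by (intro double_coset_of_rank_normal_form[OF two run(3) g _ _ _ _ _ _ C, of X' Y']) auto
    then show ?thesis using run unfolding determines_def W_hat_def by blast
  qed
  show "{\<omega>. \<exists>g \<in> (isometry_group F l :: 'k mat set). \<exists>n. determines (rank_prog (mid F)) F l g n \<omega>} = W_hat F l" for l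
  proof
    show "{\<omega>. \<exists>g \<in> (isometry_group F l :: 'k mat set). \<exists>n. determines (rank_prog (mid F)) F l g n \<omega>} \<subseteq> W_hat F l"
      unfolding determines_def W_hat_def by blast
    show "W_hat F l \<subseteq> {\<omega>. \<exists>g \<in> (isometry_group F l :: 'k mat set). \<exists>n. determines (rank_prog (mid F)) F l g n \<omega>}"
    proof
      fix \<omega> :: "'k mat" assume "\<omega> \<in> W_hat F l"
      then obtain r where r: "r \<le> l" "\<omega> = omega F l r" unfolding W_hat_def by blast
      \<comment> \<open>Each \<omega>_r is an isometry, hence an admissible input; the program is
        shown to return r on it.\<close>
      have \<omega>: "\<omega> \<in> isometry_group F l" unfolding r(2) by (rule omega_isometry[OF two r(1)])
      from rank_prog_run[OF this] obtain n R M X X' Y Y' where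
        run: "exec (rank_prog (mid F)) (input l \<omega>) n (R, M)" "R 0 \<le> l"
        and XY: "invertible_pair l X X'" "invertible_pair l Y Y'"
        and C: "mat l l (\<lambda>(i, j). \<omega> $$ (mid F + l + i, mid F + j)) = X * idem l (R 0) * Y" .
      let ?d = "\<lambda>s c. mat_diag l (\<lambda>i. if i < s then c else 0 :: 'k)"
      note C = C[unfolded r(2) omega_lower_block[OF r(1)] idem_def]
      have c: "X \<in> carrier_mat l l" "X' \<in> carrier_mat l l" "Y \<in> carrier_mat l l" "Y' \<in> carrier_mat l l"
        and i: "X' * X = 1\<^sub>m l" "Y * Y' = 1\<^sub>m l" "Y' * Y = 1\<^sub>m l"
        using XY by (auto simp: invertible_pair_def)
      \<comment> \<open>Moving Y to the left side bounds r by the computed rank; moving X below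
        gives the opposite inequality.\<close>
      have "?d r (omega_lower F) * Y' = X * ?d (R 0) 1 * (Y * Y')"
        using c unfolding C by (simp add: square_mat_assoc[of _ l] square_mat_mult[of _ l])
      then have "?d r (omega_lower F) * Y' = X * ?d (R 0) 1" using c i(2) by (simp add: square_mat_mult[of _ l])
      from idem_rank_unique[OF c(4,3) i(3) c(1) this _ r(1)] have 1: "r \<le> R 0"
        by (simp add: omega_lower_def)
      have "X' * ?d r (omega_lower F) = (X' * X) * ?d (R 0) 1 * Y"
        using c unfolding C by (simp add: square_mat_assoc[of _ l] square_mat_mult[of _ l])
      then have "?d (R 0) 1 * Y = X' * ?d r (omega_lower F)" using c i(1) by (simp add: left_mult_one_mat[OF mat_diag_carrier])
      from idem_rank_unique[OF c(3,4) i(2) c(2) this _ run(2)] have "R 0 \<le> r" by simp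
      with 1 have "R 0 = r" by simp
      then have "determines (rank_prog (mid F)) F l \<omega> n \<omega>" using run r unfolding determines_def by blast
      then show "\<omega> \<in> {\<omega>. \<exists>g \<in> (isometry_group F l :: 'k mat set). \<exists>n. determines (rank_prog (mid F)) F l g n \<omega>}"
        using \<omega> by blast
    qed
  qed
  have W: "W_hat F l = (omega F l ` {..l} :: 'k mat set)" for l unfolding W_hat_def by auto
  show "finite (W_hat F l :: 'k mat set)" for l unfolding W by simp
  show "card (W_hat F l :: 'k mat set) = l + 1" for l unfolding W by (simp add: card_image[OF inj_on_omega])
qed

end
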